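(* Suppose $y_A(\theta)\le y_P(\theta)$ for all $\theta\in\Theta$. Let $\kappa:=y_P(0)+y_P(1)$ and $y_{j,R}(\theta):=\kappa-y_j(1-\theta)$ for $j\in\{P,A\}$, and suppose that the reflected preferences have overlapping ideal-action ranges, i.e. $y_{A,R}(0)<y_{P,R}(1)$. Let $(m^*,F^* )$ be the saddle point obtained by applying the positive-bias construction (given in the context) to the reflected preferences $(y_{A,R},y_{P,R})$, with action space $\mathcal A_R=\kappa-\mathcal A$. Then the reflected pair $((m^* )_R,(F^* )_R)$ is a saddle point for the original preferences $(y_A,y_P)$: $(m^* )_R\in\mathcal M$ and $$V((m^* )_R,F)\ \ge\ V((m^* )_R,(F^* )_R)\ \ge\ V(m,(F^* )_R)\qquad\text{for all }m\in\mathcal M,\ F\in\mathcal F(\Theta).$$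
   Context: **Model.** $\Theta=[0,1]$; $\mathcal A\subset\mathbb R$ is a compact interval; $y_P,y_A:\Theta\to\mathcal A$ are continuously differentiable and strictly increasing. The bias is $b(\theta):=y_A(\theta)-y_P(\theta)$; it is assumed to be either weakly increasing on $\Theta$ or weakly decreasing on $\Theta$, and there is at most one $\theta\in\Theta$ with $b(\theta)=0$. $\mathcal F(\Theta)$ is the set of CDFs of Borel probability distributions on $\Theta$. A mechanism is a Borel probability kernel $m:\Theta\to\Delta(\mathcal A)$, where $\Delta(\mathcal A)$ is the set of Borel probability distributions on $\mathcal A$; its mean and variance functions are $\mu_m(\hat\theta)=\int a\,dm(a\mid\hat\theta)$ and $\tau_m(\hat\theta)=\int (a-\mu_m(\hat\theta))^2\,dm(a\mid\hat\theta)$. For $j\in\{P,A\}$, $U_{j,m}(\theta,\hat\theta):=-\int (a-y_j(\theta))^2\,dm(a\mid\hat\theta)$ and $U_{j,m}(\theta):=U_{j,m}(\theta,\theta)$. $\mathcal M$ is the set of incentive-compatible mechanisms, i.e. those with $U_{A,m}(\theta,\theta)\ge U_{A,m}(\theta,\hat\theta)$ for all $\theta,\hat\theta\in\Theta$. For $m\in\mathcal M$, $F\in\mathcal F(\Theta)$: $V(m,F):=\int_\Theta U_{P,m}(\theta)\,dF(\theta)$. **Reflection.** The reflection $m_R$ of a mechanism $m$ assigns to report $\theta$ the image of the lottery $m(1-\theta)$ under $a\mapsto\kappa-a$; so its mean and variance are $\mu_R(\theta)=\kappa-\mu_m(1-\theta)$ and $\tau_R(\theta)=\tau_m(1-\theta)$.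 The reflection $F_R$ of a CDF $F$ is the CDF of the image of the distribution under $\theta\mapsto1-\theta$, i.e. $F_R(\theta)=1-F((1-\theta)^-)$, where $F(x^-)$ is the left limit. **Positive-bias construction.** Write $z_P=y_{P,R}$, $z_A=y_{A,R}$, $c:=z_A-z_P\ge0$. Let $\bar\theta:=z_A^{-1}(z_P(1))\in(0,1]$. For $\theta\in[0,\bar\theta]$ with $c(\theta)>0$ let $$d(\theta):=\frac{c(\bar\theta)}{2}\exp\Bigl(-\int_\theta^{\bar\theta}\frac{z_P'(t)}{c(t)}\,dt\Bigr)+\int_\theta^{\bar\theta}z_P'(t)\exp\Bigl(-\int_\theta^t\frac{z_P'(s)}{c(s)}\,ds\Bigr)dt .$$ If $c(1)=0$ (then $\bar\theta=1$), integrals with upper endpoint $1$ are improper (one-sided limits), $\exp(-\infty)=0$, and $d(1):=0$; the same convention applies to $F^*$. Let $\underline\theta:=\inf\{\theta\in[0,\bar\theta]: c(\theta)>0,\ d(\theta)\le c(\theta)\}$. Then $m^*:\Theta\to\Delta(\mathcal A_R)$ is a Borel probability kernel with mean $\mu^*$ and variance $\tau^*$ given by: $(\mu^*,\tau^* )(\theta)=(z_A(\theta),0)$ for $0\le\theta<\underline\theta$; $(z_P(\theta)+d(\theta),\ d(\underline\theta)^2-d(\theta)^2)$ for $\underline\theta\le\theta\le\bar\theta$; $\bigl(\frac{z_P(\bar\theta)+z_P(1)}2,\ d(\underline\theta)^2-\frac{c(\bar\theta)^2}4\bigr)$ for $\bar\theta<\theta\le1$. And $$F^*(\theta)=\begin{cases}0,&\theta<\underline\theta,\\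 1-\dfrac{d(\underline\theta)}{c(\underline\theta)}\exp\Bigl(-\displaystyle\int_{\underline\theta}^{\min\{\theta,\bar\theta\}}\frac{z_A'(t)}{c(t)}\,dt\Bigr),&\underline\theta\le\theta<1,\\ 1,&\theta\ge1.\end{cases}$$ The interval $\mathcal A$ is assumed large enough that such a kernel $m^*$ into $\Delta(\mathcal A_R)$ exists. *)

theory Defs
  imports "HOL-Probability.Probability"
begin

abbreviation Theta :: "real set" where
  "Theta \<equiv> {0..1}"

section \<open>Preferences\<close>

text \<open>Derivatives are taken within the type space, hence one-sided at the end points; the values of
  a preference function outside \<open>[0,1]\<close> are irrelevant.\<close>

definition deriv_Theta :: "(real \<Rightarrow> real) \<Rightarrow> real \<Rightarrow> real" where
  "deriv_Theta f t = vector_derivative f (at t within Theta)"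

definition C1_Theta :: "(real \<Rightarrow> real) \<Rightarrow> bool" where
  "C1_Theta f \<longleftrightarrow> f differentiable_on Theta \<and> continuous_on Theta (deriv_Theta f)"

section \<open>Mechanisms, type distributions and payoffs\<close>

definition mechanism :: "real set \<Rightarrow> (real \<Rightarrow> real measure) \<Rightarrow> bool" where
  "mechanism A m \<longleftrightarrow>
     m \<in> restrict_space borel Theta \<rightarrow>\<^sub>M prob_algebra (restrict_space borel A)"

definition mech_mean :: "(real \<Rightarrow> real measure) \<Rightarrow> real \<Rightarrow> real" where
  "mech_mean m \<theta> = (LINT a|m \<theta>. a)"

definition mech_var :: "(real \<Rightarrow> real measure) \<Rightarrow> real \<Rightarrow> real" where
  "mech_var m \<theta> = (LINT a|m \<theta>. (a - mech_mean m \<theta>)\<^sup>2)"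

text \<open>\<open>payoff y m \<theta> \<theta>'\<close> is the payoff, for ideal action \<open>y\<close>, of true type \<open>\<theta>\<close> when \<open>\<theta>'\<close> is reported.\<close>

definition payoff :: "(real \<Rightarrow> real) \<Rightarrow> (real \<Rightarrow> real measure) \<Rightarrow> real \<Rightarrow> real \<Rightarrow> real" where
  "payoff y m \<theta> \<theta>' = - (LINT a|m \<theta>'. (a - y \<theta>)\<^sup>2)"

definition IC_mechanisms :: "real set \<Rightarrow> (real \<Rightarrow> real) \<Rightarrow> (real \<Rightarrow> real measure) set" where
  "IC_mechanisms A yA =
     {m. mechanism A m \<and> (\<forall>\<theta>\<in>Theta. \<forall>\<theta>'\<in>Theta. payoff yA m \<theta> \<theta> \<ge> payoff yA m \<theta> \<theta>')}"

definition CDFs_Theta :: "(real \<Rightarrow> real) set" where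
  "CDFs_Theta = {cdf M |M. real_distribution M \<and> measure M Theta = 1}"

definition value_P :: "(real \<Rightarrow> real) \<Rightarrow> (real \<Rightarrow> real measure) \<Rightarrow> (real \<Rightarrow> real) \<Rightarrow> real" where
  "value_P yP m F = (LINT \<theta>:Theta|interval_measure F. payoff yP m \<theta> \<theta>)"

definition saddle_point ::
  "real set \<Rightarrow> (real \<Rightarrow> real) \<Rightarrow> (real \<Rightarrow> real) \<Rightarrow> (real \<Rightarrow> real measure) \<Rightarrow> (real \<Rightarrow> real) \<Rightarrow> bool" where
  "saddle_point A yP yA m0 F0 \<longleftrightarrow>
     m0 \<in> IC_mechanisms A yA \<and> F0 \<in> CDFs_Theta \<and>
     (\<forall>m\<in>IC_mechanisms A yA. \<forall>F\<in>CDFs_Theta.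
        value_P yP m0 F \<ge> value_P yP m0 F0 \<and> value_P yP m0 F0 \<ge> value_P yP m F0)"

section \<open>Reflections\<close>

definition reflect_pref :: "real \<Rightarrow> (real \<Rightarrow> real) \<Rightarrow> real \<Rightarrow> real" where
  "reflect_pref \<kappa> y \<theta> = \<kappa> - y (1 - \<theta>)"

definition reflect_actions :: "real \<Rightarrow> real set \<Rightarrow> real set" where
  "reflect_actions \<kappa> B = (\<lambda>a. \<kappa> - a) ` B"

text \<open>Here \<open>B\<close> is the action space of the mechanism being reflected.\<close>

definition reflect_mech ::
  "real \<Rightarrow> real set \<Rightarrow> (real \<Rightarrow> real measure) \<Rightarrow> real \<Rightarrow> real measure" where
  "reflect_mech \<kappa> B m \<theta> =
     distr (m (1 - \<theta>)) (restrict_space borel (reflect_actions \<kappa> B)) (\<lambda>a. \<kappa> - a)"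

definition reflect_cdf :: "(real \<Rightarrow> real) \<Rightarrow> real \<Rightarrow> real" where
  "reflect_cdf F \<theta> = 1 - Lim (at_left (1 - \<theta>)) F"

section \<open>The positive-bias construction\<close>

text \<open>In this section \<open>zP\<close> and \<open>zA\<close> are ideal actions with \<open>zP \<le> zA\<close> on \<open>[0,1]\<close>.\<close>

definition pb_c :: "(real \<Rightarrow> real) \<Rightarrow> (real \<Rightarrow> real) \<Rightarrow> real \<Rightarrow> real" where
  "pb_c zP zA \<theta> = zA \<theta> - zP \<theta>"

definition pb_top :: "(real \<Rightarrow> real) \<Rightarrow> (real \<Rightarrow> real) \<Rightarrow> real" where
  "pb_top zP zA = the_inv_into Theta zA (zP 1)"

text \<open>If \<open>c 1 = 0\<close>, integrals with upper end point \<open>1\<close> are improper. The exponential of minus such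
  an integral is the one-sided limit of exponentials, which is \<open>0\<close> when the integral diverges
  to infinity.\<close>

definition improper_int :: "(real \<Rightarrow> real) \<Rightarrow> (real \<Rightarrow> real) \<Rightarrow> real \<Rightarrow> real \<Rightarrow> real" where
  "improper_int c f a b =
     (if c 1 = 0 \<and> b = 1 then Lim (at_left 1) (\<lambda>u. integral {a..u} f) else integral {a..b} f)"

definition exp_neg_int :: "(real \<Rightarrow> real) \<Rightarrow> (real \<Rightarrow> real) \<Rightarrow> real \<Rightarrow> real \<Rightarrow> real" where
  "exp_neg_int c f a b =
     (if c 1 = 0 \<and> b = 1 then Lim (at_left 1) (\<lambda>u. exp (- integral {a..u} f))
      else exp (- integral {a..b} f))"

text \<open>Only meaningful for \<open>\<theta> \<in> [0, pb_top zP zA]\<close> with \<open>c \<theta> > 0\<close>, or for \<open>\<theta> = 1\<close> if \<open>c 1 = 0\<close>.\<close>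

definition pb_d :: "(real \<Rightarrow> real) \<Rightarrow> (real \<Rightarrow> real) \<Rightarrow> real \<Rightarrow> real" where
  "pb_d zP zA \<theta> =
     (let c = pb_c zP zA; top = pb_top zP zA; r = (\<lambda>s. deriv_Theta zP s / c s) in
      if c 1 = 0 \<and> \<theta> = 1 then 0
      else c top / 2 * exp_neg_int c r \<theta> top
           + improper_int c (\<lambda>t. deriv_Theta zP t * exp_neg_int c r \<theta> t) \<theta> top)"

definition pb_bot :: "(real \<Rightarrow> real) \<Rightarrow> (real \<Rightarrow> real) \<Rightarrow> real" where
  "pb_bot zP zA =
     Inf {\<theta> \<in> {0..pb_top zP zA}. pb_c zP zA \<theta> > 0 \<and> pb_d zP zA \<theta> \<le> pb_c zP zA \<theta>}"

definition pb_mean :: "(real \<Rightarrow> real) \<Rightarrow> (real \<Rightarrow> real) \<Rightarrow> real \<Rightarrow> real" where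
  "pb_mean zP zA \<theta> =
     (if \<theta> < pb_bot zP zA then zA \<theta>
      else if \<theta> \<le> pb_top zP zA then zP \<theta> + pb_d zP zA \<theta>
      else (zP (pb_top zP zA) + zP 1) / 2)"

definition pb_var :: "(real \<Rightarrow> real) \<Rightarrow> (real \<Rightarrow> real) \<Rightarrow> real \<Rightarrow> real" where
  "pb_var zP zA \<theta> =
     (if \<theta> < pb_bot zP zA then 0
      else if \<theta> \<le> pb_top zP zA then (pb_d zP zA (pb_bot zP zA))\<^sup>2 - (pb_d zP zA \<theta>)\<^sup>2
      else (pb_d zP zA (pb_bot zP zA))\<^sup>2 - (pb_c zP zA (pb_top zP zA))\<^sup>2 / 4)"

text \<open>The construction fixes only the mean and variance of each lottery, so it is a property of
  mechanisms; whether some mechanism has it depends on the size of the action space \<open>B\<close>.\<close>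

definition pb_mechanism ::
  "real set \<Rightarrow> (real \<Rightarrow> real) \<Rightarrow> (real \<Rightarrow> real) \<Rightarrow> (real \<Rightarrow> real measure) \<Rightarrow> bool" where
  "pb_mechanism B zP zA m \<longleftrightarrow>
     mechanism B m \<and>
     (\<forall>\<theta>\<in>Theta. mech_mean m \<theta> = pb_mean zP zA \<theta> \<and> mech_var m \<theta> = pb_var zP zA \<theta>)"

definition pb_cdf :: "(real \<Rightarrow> real) \<Rightarrow> (real \<Rightarrow> real) \<Rightarrow> real \<Rightarrow> real" where
  "pb_cdf zP zA \<theta> =
     (let c = pb_c zP zA; bot = pb_bot zP zA; top = pb_top zP zA in
      if \<theta> < bot then 0
      else if \<theta> < 1 then
        1 - pb_d zP zA bot / c bot * exp_neg_int c (\<lambda>t. deriv_Theta zA t / c t) bot (min \<theta> top)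
      else 1)"

end

theory Submission
  imports Defs
begin

text \<open>
  Reflection turns the problem into the positive-bias one, with \<open>c = zA - zP \<ge> 0\<close>. There
  \<open>d\<close> solves \<open>d' = zP' (d - c) / c\<close>, which makes \<open>d \<le> c\<close> on the interval from \<open>bt\<close> (the lower
  threshold) to \<open>tp\<close> (the upper one), makes the moments of the saddle mechanism satisfy the
  envelope condition \<open>(E a\<^sup>2)' = 2 zA \<mu>'\<close>, and makes the principal's payoff equal to \<open>- d(bt)\<^sup>2\<close> on the
  support of \<open>F\<^sup>*\<close> and at least that elsewhere.

  Conversely, let \<open>m\<close> be incentive compatible with mean \<open>\<mu>\<close>, let \<open>W = 2 zA \<mu> - E a\<^sup>2\<close> and \<open>G = 1 - F\<^sup>*\<close>, so
  that \<open>G' = - g\<close> with \<open>g = G zA' / c\<close>. The principal's payoff is \<open>W - 2 c \<mu> - zP\<^sup>2\<close>, and the envelope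
  condition \<open>W' = 2 \<mu> zA'\<close> gives \<open>(W - 2 c \<mu>) g = - (W G)'\<close>. Hence up to a constant the value of \<open>m\<close> under
  \<open>F\<^sup>*\<close> is \<open>W(bt) - 2 (c - d)(bt) \<mu>(bt) + G(tp) (W(1) - W(tp) - 2 c(1) \<mu>(1))\<close>: the first two terms are
  maximal for the deterministic action \<open>zP(bt) + d(bt)\<close>, and the last one is at most \<open>0\<close> with equality
  when \<open>m\<close> is constant above \<open>tp\<close>.
\<close>

text \<open>The equation for \<open>d\<close> is forced. With mean \<open>zP + d\<close>, constancy
  of the principal's payoff \<open>- d\<^sup>2 - \<tau>\<close> makes the second moment a constant
  plus \<open>zP\<^sup>2 + 2 zP d\<close>, and the envelope condition then reads
  \<open>zP' d = c (zP' + d')\<close>. Since \<open>zA tp = zP 1\<close>, one has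
  \<open>c tp = zP 1 - zP tp\<close>; the boundary value \<open>d tp = c tp / 2\<close> puts the
  mean at \<open>tp\<close> at the midpoint of \<open>zP tp\<close> and \<open>zP 1\<close>, where
  the pooled mean above \<open>tp\<close> lies. Likewise \<open>g = G zA' / c\<close> is the density
  for which the terms in \<open>\<mu>\<close> cancel inside the interval, and
  \<open>G bt = d bt / c bt\<close> is the mass for which the terms left over at \<open>bt\<close>
  are maximal at \<open>\<mu> = zP bt + d bt\<close>.

  The obstacle is the top when \<open>c 1 = 0\<close>. Then \<open>tp = 1\<close> and the rates
  \<open>zP' / c\<close> and \<open>zA' / c\<close> may be singular there, so \<open>d\<close> and
  \<open>G\<close> are controlled on intervals ending before \<open>tp\<close> and continued by
  one-sided limits. A zero of \<open>c\<close> at the type \<open>0\<close> does no harm, because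
  \<open>c bt > 0\<close> keeps \<open>bt\<close> away from it.\<close>

section \<open>One-sided calculus and a comparison principle\<close>

lemma has_real_derivative_nonneg_of_mono_on:
  fixes f :: "real \<Rightarrow> real"
  assumes "mono_on S f" and "t \<in> S" and "t islimpt S"
    and "(f has_real_derivative D) (at t within S)"
  shows "D \<ge> 0"
proof -
  have lim: "((\<lambda>y. (f y - f t) / (y - t)) \<longlongrightarrow> D) (at t within S)"
    using assms(4) by (simp add: has_field_derivative_iff)
  have "eventually (\<lambda>y. 0 \<le> (f y - f t) / (y - t)) (at t within S)"
    unfolding eventually_at_filter
  proof (intro always_eventually allI impI)
    fix y assume "y \<noteq> t" "y \<in> S"
    then show "0 \<le> (f y - f t) / (y - t)"
      using assms(1,2) by (cases "y < t") (auto simp: mono_on_def divide_simps)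
  qed
  then show ?thesis
    using tendsto_lowerbound[OF lim] assms(3) trivial_limit_within by blast
qed

text \<open>For the top type, where \<open>c\<close> may vanish: the quantities whose left limit is
  needed there are monotone and bounded.\<close>

lemma bounded_mono_on_at_left:
  fixes f :: "real \<Rightarrow> real"
  assumes ab: "a < b" and mono: "\<And>x y. a \<le> x \<Longrightarrow> x \<le> y \<Longrightarrow> y < b \<Longrightarrow> f x \<le> f y"
    and bd: "\<And>x. a \<le> x \<Longrightarrow> x < b \<Longrightarrow> f x \<le> B"
  obtains l where "(f \<longlongrightarrow> l) (at_left b)" and "\<And>x. a \<le> x \<Longrightarrow> x < b \<Longrightarrow> f x \<le> l"
proof
  let ?l = "Sup (f ` {a..<b})"
  have bdd: "bdd_above (f ` {a..<b})" using bd by (auto intro!: bdd_aboveI)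
  show le: "f x \<le> ?l" if "a \<le> x" "x < b" for x
    using that bdd by (auto intro!: cSup_upper)
  show "(f \<longlongrightarrow> ?l) (at_left b)"
  proof (rule increasing_tendsto)
    show "eventually (\<lambda>x. f x \<le> ?l) (at_left b)"
      using eventually_at_left_real[OF ab] by eventually_elim (auto intro: le)
    fix y assume "y < ?l"
    then obtain x where x: "a \<le> x" "x < b" "y < f x"
      using less_cSup_iff[OF _ bdd, of y] ab by auto
    show "eventually (\<lambda>x. y < f x) (at_left b)"
      using eventually_at_left_real[OF x(2)]
      by eventually_elim (use x mono in \<open>auto intro: less_le_trans\<close>)
  qed
qed

text \<open>The integrating factor \<open>exp (- R)\<close> leaves the nonnegative derivative
  \<open>exp (- R) * q\<close>. The factor \<open>k\<close> is not made explicit: as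
  \<open>b\<close> approaches \<open>tp\<close> the integral \<open>R b\<close> may diverge, and
  only \<open>0 < k\<close> and \<open>k \<le> 1\<close> are uniform in \<open>b\<close>.\<close>

lemma ode_compare:
  fixes f r q :: "real \<Rightarrow> real"
  assumes ab: "a \<le> b" and r: "continuous_on {a..b} r" "\<And>t. t \<in> {a..b} \<Longrightarrow> 0 \<le> r t"
    and q: "\<And>t. t \<in> {a..b} \<Longrightarrow> 0 \<le> q t"
    and f: "\<And>t. t \<in> {a..b} \<Longrightarrow> (f has_real_derivative r t * f t + q t) (at t within {a..b})"
  obtains k where "0 < k" "k \<le> 1" "f a \<le> k * f b"
proof
  define R where "R t = integral {a..t} r" for t
  have R: "(R has_real_derivative r t) (at t within {a..b})" if "t \<in> {a..b}" for t
    unfolding R_def by (rule integral_has_real_derivative[OF r(1) that])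
  have D: "((\<lambda>t. exp (- R t) * f t) has_real_derivative exp (- R t) * q t) (at t within {a..b})"
    if "t \<in> {a..b}" for t
    by (rule derivative_eq_intros R f that refl)+ (simp add: algebra_simps)
  have "exp (- R a) * f a \<le> exp (- R b) * f b"
  proof (rule DERIV_nonneg_imp_increasing_open[OF ab])
    show "continuous_on {a..b} (\<lambda>t. exp (- R t) * f t)"
      using D by (rule DERIV_continuous_on)
    fix t assume t: "a < t" "t < b"
    then show "\<exists>y. ((\<lambda>t. exp (- R t) * f t) has_real_derivative y) (at t) \<and> 0 \<le> y"
      using D[of t] q[of t] by (auto simp: at_within_Icc_at)
  qed
  then show "f a \<le> exp (- R b) * f b"
    by (simp add: R_def)
  have "0 \<le> R b" unfolding R_def
    by (rule integral_nonneg[OF integrable_continuous_real[OF r(1)]]) (use r in auto)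
  then show "exp (- R b) \<le> 1" by simp
qed auto

lemma C1_Theta_has_real_derivative:
  assumes "C1_Theta y" "t \<in> Theta"
  shows "(y has_real_derivative deriv_Theta y t) (at t within Theta)"
  using assms unfolding C1_Theta_def deriv_Theta_def differentiable_on_def
  by (metis has_real_derivative_iff_has_vector_derivative vector_derivative_works)

lemma C1_Theta_continuous_on: "C1_Theta y \<Longrightarrow> continuous_on Theta y"
  by (meson C1_Theta_has_real_derivative DERIV_continuous_on)

lemma C1_Theta_deriv_nonneg:
  assumes "C1_Theta y" "mono_on Theta y" "t \<in> Theta"
  shows "0 \<le> deriv_Theta y t"
proof (rule has_real_derivative_nonneg_of_mono_on[OF assms(2,3)])
  show "(y has_real_derivative deriv_Theta y t) (at t within Theta)"
    by (rule C1_Theta_has_real_derivative) fact+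
  show "t islimpt Theta"
    by (rule connected_imp_perfect[OF _ assms(3)]) auto
qed

section \<open>The differential equation for the deviation\<close>

text \<open>Only preferences are fixed. The action space enters the later results through a bound
  \<open>A \<subseteq> {-B..B}\<close>, which makes all moments finite.\<close>

locale positive_bias =
  fixes zP zA :: "real \<Rightarrow> real"
  assumes C1_P: "C1_Theta zP" and C1_A: "C1_Theta zA"
    and mono_P: "strict_mono_on Theta zP" and mono_A: "strict_mono_on Theta zA"
    and bias_nonneg: "\<And>\<theta>. \<theta> \<in> Theta \<Longrightarrow> 0 \<le> pb_c zP zA \<theta>"
    and bias_mono: "mono_on Theta (pb_c zP zA) \<or> antimono_on Theta (pb_c zP zA)"
    and bias_zero: "\<And>\<theta> \<theta>'. \<theta> \<in> Theta \<Longrightarrow> \<theta>' \<in> Theta \<Longrightarrow>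
      pb_c zP zA \<theta> = 0 \<Longrightarrow> pb_c zP zA \<theta>' = 0 \<Longrightarrow> \<theta> = \<theta>'"
    and overlap: "zA 0 < zP 1"
begin

abbreviation "c \<equiv> pb_c zP zA"
abbreviation "d \<equiv> pb_d zP zA"
abbreviation "bt \<equiv> pb_bot zP zA"
abbreviation "tp \<equiv> pb_top zP zA"
abbreviation "dP \<equiv> deriv_Theta zP"
abbreviation "dA \<equiv> deriv_Theta zA"

lemmas deriv_P = C1_Theta_has_real_derivative[OF C1_P]
lemmas deriv_A = C1_Theta_has_real_derivative[OF C1_A]
lemmas cont_P = C1_Theta_continuous_on[OF C1_P]
lemmas cont_A = C1_Theta_continuous_on[OF C1_A]

lemma cont_dP: "continuous_on Theta dP" and cont_dA: "continuous_on Theta dA"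
  using C1_P C1_A by (auto simp: C1_Theta_def)

lemma dP_nonneg: "t \<in> Theta \<Longrightarrow> 0 \<le> dP t" and dA_nonneg: "t \<in> Theta \<Longrightarrow> 0 \<le> dA t"
  using C1_Theta_deriv_nonneg C1_P C1_A mono_P mono_A strict_mono_on_imp_mono_on by blast+

lemma zP_le: "0 \<le> x \<Longrightarrow> x \<le> y \<Longrightarrow> y \<le> 1 \<Longrightarrow> zP x \<le> zP y"
  and zA_le: "0 \<le> x \<Longrightarrow> x \<le> y \<Longrightarrow> y \<le> 1 \<Longrightarrow> zA x \<le> zA y"
  using mono_P mono_A by (auto dest!: strict_mono_on_imp_mono_on simp: mono_on_def)

lemma cont_c: "continuous_on Theta c"
  unfolding pb_c_def by (intro continuous_intros cont_A cont_P)

lemma deriv_c: "t \<in> Theta \<Longrightarrow> (c has_real_derivative dA t - dP t) (at t within Theta)"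
  unfolding pb_c_def[abs_def] by (intro derivative_intros deriv_A deriv_P)

text \<open>A monotone nonnegative function with an interior zero also vanishes at the end point on
  its lower side, and the bias has at most one zero.\<close>

lemma c_pos: assumes "0 < t" "t < 1" shows "0 < c t"
proof -
  have "c t \<noteq> 0"
  proof
    assume t: "c t = 0"
    from bias_mono have "c 0 = 0 \<or> c 1 = 0"
    proof
      assume "mono_on Theta c"
      from mono_onD[OF this, of 0 t] show ?thesis
        using assms t bias_nonneg[of 0] by auto
    next
      assume "antimono_on Theta c"
      from monotone_onD[OF this, of t 1] show ?thesis
        using assms t bias_nonneg[of 1] by auto
    qed
    then show False
      using bias_zero[of t 0] bias_zero[of t 1] t assms by auto
  qed
  then show ?thesis using bias_nonneg[of t] assms by simp
qed

lemma top: "0 < tp" "tp \<le> 1" and zA_top: "zA tp = zP 1"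
proof -
  have inj: "inj_on zA Theta" using mono_A by (rule strict_mono_on_imp_inj_on)
  have "zP 1 \<le> zA 1" using bias_nonneg[of 1] by (simp add: pb_c_def)
  then obtain x where x: "0 \<le> x" "x \<le> 1" "zA x = zP 1"
    using IVT'[of zA 0 "zP 1" 1] overlap cont_A by auto
  then have "tp = x"
    unfolding pb_top_def using inj by (intro the_inv_into_f_eq) auto
  then show "0 < tp" "tp \<le> 1" "zA tp = zP 1"
    using x overlap by (auto simp: less_le)
qed

lemma c_top: "c tp = zP 1 - zP tp"
  by (simp add: pb_c_def zA_top)

lemma top_eq_1: "c 1 = 0 \<Longrightarrow> tp = 1"
  using zA_top strict_mono_on_imp_inj_on[OF mono_A] top
  by (auto simp: pb_c_def inj_on_def)

text \<open>\<open>c tp\<close> is the increment of the strictly increasing \<open>zP\<close> over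
  \<open>[tp, 1]\<close>, so it vanishes only if \<open>tp = 1\<close>. Hence the boundary value of
  \<open>d\<close> is zero exactly in the improper case.\<close>

lemma c_top_zero: "c tp = 0 \<longleftrightarrow> c 1 = 0"
proof
  assume "c tp = 0"
  then have "tp = 1"
    using strict_mono_on_imp_inj_on[OF mono_P] top by (auto simp: c_top inj_on_def)
  with \<open>c tp = 0\<close> show "c 1 = 0" by simp
qed (use top_eq_1 in auto)

text \<open>The disjunction on \<open>t\<close> recurs below: it is the range in which division by
  \<open>c\<close> is safe, namely up to \<open>tp\<close>, with \<open>tp\<close> included unless
  \<open>c\<close> vanishes there.\<close>

lemma c_pos_right:
  assumes "0 \<le> a" "0 < c a" "a \<le> t" "t < tp \<or> t = tp \<and> c 1 \<noteq> 0"
  shows "0 < c t"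
proof (cases "t = a \<or> t = 1")
  case True
  then show ?thesis
    using assms top bias_nonneg[of 1] by auto
next
  case False
  then show ?thesis using c_pos[of t] assms top by auto
qed

lemma cont_rate:
  assumes "0 \<le> a" "0 < c a" "b < tp \<or> b = tp \<and> c 1 \<noteq> 0"
    and "continuous_on Theta f"
  shows "continuous_on {a..b} (\<lambda>t. f t / c t)"
proof -
  have *: "c t \<noteq> 0" if "t \<in> {a..b}" for t
    using c_pos_right[of a t] assms that by fastforce
  have sub: "{a..b} \<subseteq> Theta" using assms(1,3) top by auto
  show ?thesis
    using * by (intro continuous_on_divide continuous_on_subset[OF assms(4)]
      continuous_on_subset[OF cont_c] sub) auto
qed

lemma pb_d_top: "d tp = c tp / 2"
proof (cases "c 1 = 0")
  case True
  then show ?thesis by (simp add: pb_d_def Let_def top_eq_1)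
next
  case False
  then show ?thesis by (simp add: pb_d_def Let_def exp_neg_int_def improper_int_def)
qed

text \<open>Variation of constants. The closed form of \<open>d\<close> serves only to obtain the
  differential equation and the limit at \<open>tp\<close>; later arguments use these two
  facts.\<close>

lemma pb_d_solution:
  assumes a: "0 \<le> a" "a < tp" "0 < c a"
  shows pb_d_deriv: "\<And>\<theta> u. a \<le> \<theta> \<Longrightarrow> \<theta> \<le> u \<Longrightarrow> u < tp \<Longrightarrow>
      (d has_real_derivative dP \<theta> / c \<theta> * (d \<theta> - c \<theta>)) (at \<theta> within {a..u})"
    and pb_d_tendsto_top: "(d \<longlongrightarrow> c tp / 2) (at_left tp)"
proof -
  \<comment> \<open>With a fixed base point \<open>a\<close> the inner exponential in the definition
    of \<open>d\<close> is \<open>exp (R \<theta> - R t)\<close>. So \<open>\<theta>\<close> leaves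
    the integrand, and \<open>d \<theta> = exp (R \<theta>) * (K - Q \<theta>)\<close> can be
    differentiated by the product rule.\<close>
  define r where "r t = dP t / c t" for t
  define R where "R t = integral {a..t} r" for t
  define p where "p t = dP t * exp (- R t)" for t
  define Q where "Q t = integral {a..t} p" for t
  define ok where "ok u \<longleftrightarrow> u < tp \<or> u = tp \<and> c 1 \<noteq> 0" for u
  have r_cont: "continuous_on {a..u} r" if "ok u" for u
    using cont_rate[OF a(1,3) _ cont_dP, of u] that unfolding ok_def r_def[abs_def] by auto
  have r_nonneg: "0 \<le> r t" if "a \<le> t" "ok t" for t
    using c_pos_right[OF a(1,3) that(1)] that dP_nonneg[of t] a top by (auto simp: ok_def r_def)
  have R_deriv: "(R has_real_derivative r t) (at t within {a..u})" if "ok u" "t \<in> {a..u}" for t u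
    unfolding R_def[abs_def] by (rule integral_has_real_derivative[OF r_cont that(2)]) fact
  have p_cont: "continuous_on {a..u} p" if "ok u" for u
  proof -
    have "{a..u} \<subseteq> Theta" using that a top by (auto simp: ok_def)
    moreover have "continuous_on {a..u} R"
      using R_deriv[OF that] by (rule DERIV_continuous_on)
    ultimately show ?thesis
      unfolding p_def[abs_def] by (intro continuous_intros continuous_on_subset[OF cont_dP])
  qed
  have Q_deriv: "(Q has_real_derivative p t) (at t within {a..u})" if "ok u" "t \<in> {a..u}" for t u
    unfolding Q_def[abs_def] by (rule integral_has_real_derivative[OF p_cont that(2)]) fact
  have R_diff: "integral {\<theta>..t} r = R t - R \<theta>" if "a \<le> \<theta>" "\<theta> \<le> t" "ok t" for \<theta> t
    using Henstock_Kurzweil_Integration.integral_combine[OF that(1,2) integrable_continuous_real[OF r_cont[OF that(3)]]]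
    by (simp add: R_def)
  have Q_diff: "integral {\<theta>..t} p = Q t - Q \<theta>" if "a \<le> \<theta>" "\<theta> \<le> t" "ok t" for \<theta> t
    using Henstock_Kurzweil_Integration.integral_combine[OF that(1,2) integrable_continuous_real[OF p_cont[OF that(3)]]]
    by (simp add: Q_def)
  have eni: "exp_neg_int c r \<theta> t = exp (R \<theta> - R t)" if "a \<le> \<theta>" "\<theta> \<le> t" "ok t" for \<theta> t
    using R_diff[OF that] that(3) top_eq_1 by (auto simp: exp_neg_int_def ok_def)
  have ok_mono: "ok t" if "t \<le> u" "ok u" for t u
    using that by (auto simp: ok_def)
  have ii: "integral {\<theta>..u} (\<lambda>t. dP t * exp_neg_int c r \<theta> t) = exp (R \<theta>) * (Q u - Q \<theta>)"
    if "a \<le> \<theta>" "\<theta> \<le> u" "ok u" for \<theta> u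
  proof -
    have "integral {\<theta>..u} (\<lambda>t. dP t * exp_neg_int c r \<theta> t) = integral {\<theta>..u} (\<lambda>t. exp (R \<theta>) * p t)"
      by (rule integral_cong)
        (use that in \<open>auto simp: eni[OF that(1) _ ok_mono] p_def exp_diff exp_minus field_simps\<close>)
    then show ?thesis using Q_diff[OF that] by simp
  qed
  have r_eq: "(\<lambda>s. dP s / c s) = r" by (simp add: r_def[abs_def])
  \<comment> \<open>In the regular case \<open>K\<close> is \<open>Q tp\<close> plus the discounted
    boundary term. In the improper case the boundary term vanishes and \<open>K\<close> is the left
    limit of \<open>Q\<close>.\<close>
  have "\<exists>K. (\<forall>\<theta>. a \<le> \<theta> \<and> \<theta> < tp \<longrightarrow> d \<theta> = exp (R \<theta>) * (K - Q \<theta>)) \<and> (d \<longlongrightarrow> c tp / 2) (at_left tp)"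
  proof (cases "c 1 = 0")
    case False
    let ?K = "c tp / 2 * exp (- R tp) + Q tp"
    have ok: "ok tp" using False by (simp add: ok_def)
    have eq: "d \<theta> = exp (R \<theta>) * (?K - Q \<theta>)" if "a \<le> \<theta>" "\<theta> \<le> tp" for \<theta>
    proof -
      have "d \<theta> = c tp / 2 * exp (R \<theta> - R tp) + exp (R \<theta>) * (Q tp - Q \<theta>)"
        using False eni[OF that ok] ii[OF that ok] by (simp add: pb_d_def Let_def r_eq improper_int_def)
      then show ?thesis by (simp add: exp_diff exp_minus field_simps)
    qed
    have "continuous_on {a..tp} (\<lambda>\<theta>. exp (R \<theta>) * (?K - Q \<theta>))"
      using DERIV_continuous_on[OF R_deriv[OF ok]] DERIV_continuous_on[OF Q_deriv[OF ok]]
      by (intro continuous_intros)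
    then have "((\<lambda>\<theta>. exp (R \<theta>) * (?K - Q \<theta>)) \<longlongrightarrow> exp (R tp) * (?K - Q tp)) (at_left tp)"
      using a(2) by (rule continuous_on_Icc_at_leftD)
    moreover have "eventually (\<lambda>\<theta>. exp (R \<theta>) * (?K - Q \<theta>) = d \<theta>) (at_left tp)"
      using eventually_at_left_real[OF a(2)] by eventually_elim (simp add: eq)
    ultimately have "(d \<longlongrightarrow> exp (R tp) * (?K - Q tp)) (at_left tp)"
      by (rule Lim_transform_eventually)
    moreover have "exp (R tp) * (?K - Q tp) = c tp / 2"
      by (simp add: exp_minus field_simps)
    ultimately have "(d \<longlongrightarrow> c tp / 2) (at_left tp)"
      by (simp only:)
    then show ?thesis using eq by (intro exI[of _ ?K]) auto
  next
    case True
    note tp1 = top_eq_1[OF True]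
    have ok: "ok u" if "u < 1" for u using that by (simp add: ok_def tp1)
    \<comment> \<open>The weight \<open>exp (R \<theta> - R t)\<close> is at most \<open>1\<close>,
      so the truncated integral is dominated by that of \<open>dP\<close>. The bound is used twice:
      it makes \<open>Q\<close> converge, and in the limit it squeezes \<open>d \<theta>\<close>
      between \<open>0\<close> and \<open>zP 1 - zP \<theta>\<close>, which tends to
      \<open>0\<close>.\<close>
    have bound: "0 \<le> exp (R \<theta>) * (Q u - Q \<theta>) \<and> exp (R \<theta>) * (Q u - Q \<theta>) \<le> zP 1 - zP \<theta>"
      if "a \<le> \<theta>" "\<theta> \<le> u" "u < 1" for \<theta> u
    proof -
      have sub: "{\<theta>..u} \<subseteq> Theta" using that a by auto
      have "R \<theta> \<le> R t" if "\<theta> \<le> t" "t \<le> u" for t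
      proof -
        have "0 \<le> integral {\<theta>..t} r"
          using that \<open>a \<le> \<theta>\<close> \<open>u < 1\<close>
          by (intro integral_nonneg integrable_continuous_real continuous_on_subset[OF r_cont[OF ok, of u]])
            (auto intro!: r_nonneg ok)
        then show ?thesis using R_diff[of \<theta> t] ok[of t] that \<open>a \<le> \<theta>\<close> \<open>u < 1\<close> by simp
      qed
      then have le1: "exp (R \<theta> - R t) \<le> 1" if "t \<in> {\<theta>..u}" for t
        using that by simp
      have eq: "exp (R \<theta>) * (Q u - Q \<theta>) = integral {\<theta>..u} (\<lambda>t. exp (R \<theta>) * p t)"
        using Q_diff[OF that(1,2) ok[OF that(3)]] by simp
      have int1: "(\<lambda>t. exp (R \<theta>) * p t) integrable_on {\<theta>..u}"
        using that by (intro integrable_continuous_real continuous_intros continuous_on_subset[OF p_cont[OF ok, of u]]) auto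
      have dP_int: "(dP has_integral (zP u - zP \<theta>)) {\<theta>..u}"
        by (rule fundamental_theorem_of_calculus[OF that(2)])
          (use sub in \<open>auto simp: has_real_derivative_iff_has_vector_derivative[symmetric] intro!: DERIV_subset[OF deriv_P]\<close>)
      have "integral {\<theta>..u} (\<lambda>t. exp (R \<theta>) * p t) \<le> integral {\<theta>..u} dP"
      proof (rule integral_le[OF int1])
        show "dP integrable_on {\<theta>..u}" using dP_int by blast
        fix t assume t: "t \<in> {\<theta>..u}"
        have "exp (R \<theta>) * p t = dP t * exp (R \<theta> - R t)"
          by (simp add: p_def exp_diff exp_minus field_simps)
        also have "\<dots> \<le> dP t * 1" using t le1 sub dP_nonneg by (intro mult_left_mono) auto
        finally show "exp (R \<theta>) * p t \<le> dP t" by simp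
      qed
      moreover have "0 \<le> integral {\<theta>..u} (\<lambda>t. exp (R \<theta>) * p t)"
        using int1 sub dP_nonneg by (intro integral_nonneg) (auto simp: p_def)
      moreover have "zP u \<le> zP 1" using that a by (intro zP_le) auto
      ultimately show ?thesis using eq dP_int by (simp add: integral_unique)
    qed
    have Q_mono: "Q x \<le> Q y" if "a \<le> x" "x \<le> y" "y < tp" for x y
      using bound[of x y] that by (auto simp: tp1 zero_le_mult_iff)
    have Q_bd: "Q x \<le> zP 1 - zP a" if "a \<le> x" "x < tp" for x
      using bound[of a x] that by (auto simp: tp1 R_def Q_def)
    obtain K where K: "(Q \<longlongrightarrow> K) (at_left tp)" "\<And>x. a \<le> x \<Longrightarrow> x < tp \<Longrightarrow> Q x \<le> K"
      using bounded_mono_on_at_left[of a tp Q "zP 1 - zP a"] a(2) Q_mono Q_bd by blast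
    have eq: "d \<theta> = exp (R \<theta>) * (K - Q \<theta>)" and bd: "0 \<le> d \<theta>" "d \<theta> \<le> zP 1 - zP \<theta>"
      if \<theta>: "a \<le> \<theta>" "\<theta> < tp" for \<theta>
    proof -
      have lim: "((\<lambda>u. exp (R \<theta>) * (Q u - Q \<theta>)) \<longlongrightarrow> exp (R \<theta>) * (K - Q \<theta>)) (at_left tp)"
        by (intro tendsto_intros K)
      have ev: "eventually (\<lambda>u. exp (R \<theta>) * (Q u - Q \<theta>) = integral {\<theta>..u} (\<lambda>t. dP t * exp_neg_int c r \<theta> t)) (at_left tp)"
        using eventually_at_left_real[OF \<theta>(2)]
        by eventually_elim (use \<theta> ii ok in \<open>auto simp: tp1\<close>)
      have "Lim (at_left tp) (\<lambda>u. integral {\<theta>..u} (\<lambda>t. dP t * exp_neg_int c r \<theta> t)) = exp (R \<theta>) * (K - Q \<theta>)"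
        by (intro tendsto_Lim Lim_transform_eventually[OF lim ev]) auto
      then show eq: "d \<theta> = exp (R \<theta>) * (K - Q \<theta>)"
        using True \<theta> by (simp add: pb_d_def Let_def r_eq improper_int_def tp1)
      have ev2: "eventually (\<lambda>u. 0 \<le> exp (R \<theta>) * (Q u - Q \<theta>) \<and> exp (R \<theta>) * (Q u - Q \<theta>) \<le> zP 1 - zP \<theta>) (at_left tp)"
        using eventually_at_left_real[OF \<theta>(2)]
        by eventually_elim (use \<theta> bound in \<open>auto simp: tp1\<close>)
      show "0 \<le> d \<theta>" unfolding eq
        by (rule tendsto_lowerbound[OF lim]) (use ev2 in \<open>auto elim: eventually_mono\<close>)
      show "d \<theta> \<le> zP 1 - zP \<theta>" unfolding eq
        by (rule tendsto_upperbound[OF lim]) (use ev2 in \<open>auto elim: eventually_mono\<close>)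
    qed
    have "((\<lambda>\<theta>. zP 1 - zP \<theta>) \<longlongrightarrow> zP 1 - zP tp) (at_left tp)"
    proof -
      have "(zP \<longlongrightarrow> zP tp) (at tp within {a..tp})"
        using continuous_on_subset[OF cont_P, of "{a..tp}"] a top by (auto simp: continuous_on)
      then show ?thesis
        using a(2) by (intro tendsto_intros) (simp add: at_within_Icc_at_left)
    qed
    then have "((\<lambda>\<theta>. zP 1 - zP \<theta>) \<longlongrightarrow> 0) (at_left tp)"
      by (simp add: tp1)
    moreover have "eventually (\<lambda>\<theta>. 0 \<le> d \<theta>) (at_left tp)"
      "eventually (\<lambda>\<theta>. d \<theta> \<le> zP 1 - zP \<theta>) (at_left tp)"
      using eventually_at_left_real[OF a(2)] by (eventually_elim, simp add: bd)+
    ultimately have "(d \<longlongrightarrow> 0) (at_left tp)"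
      using tendsto_sandwich[of "\<lambda>_. 0" d "at_left tp" "\<lambda>\<theta>. zP 1 - zP \<theta>" 0] by simp
    then show ?thesis using eq True by (intro exI[of _ K]) (auto simp: tp1)
  qed
  then obtain K where K: "\<And>\<theta>. a \<le> \<theta> \<Longrightarrow> \<theta> < tp \<Longrightarrow> d \<theta> = exp (R \<theta>) * (K - Q \<theta>)"
    and lim: "(d \<longlongrightarrow> c tp / 2) (at_left tp)"
    by blast
  show "(d \<longlongrightarrow> c tp / 2) (at_left tp)" by fact
  fix \<theta> u assume \<theta>: "a \<le> \<theta>" "\<theta> \<le> u" "u < tp"
  have ok: "ok u" using \<theta> by (simp add: ok_def)
  have "c \<theta> > 0" using c_pos_right[OF a(1,3) \<theta>(1)] \<theta> by simp
  have in_u: "\<theta> \<in> {a..u}" using \<theta> by simp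
  have "((\<lambda>\<theta>. exp (R \<theta>) * (K - Q \<theta>)) has_real_derivative
      exp (R \<theta>) * r \<theta> * (K - Q \<theta>) + (0 - p \<theta>) * exp (R \<theta>)) (at \<theta> within {a..u})"
    by (intro DERIV_mult DERIV_chain2[OF DERIV_exp] DERIV_diff DERIV_const R_deriv[OF ok in_u] Q_deriv[OF ok in_u])
  moreover have "exp (R \<theta>) * r \<theta> * (K - Q \<theta>) + (0 - p \<theta>) * exp (R \<theta>) = dP \<theta> / c \<theta> * (d \<theta> - c \<theta>)"
    using \<theta> \<open>c \<theta> > 0\<close> by (simp add: K p_def r_def exp_minus field_simps)
  ultimately have "((\<lambda>\<theta>. exp (R \<theta>) * (K - Q \<theta>)) has_real_derivative dP \<theta> / c \<theta> * (d \<theta> - c \<theta>)) (at \<theta> within {a..u})"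
    by (simp only:)
  then show "(d has_real_derivative dP \<theta> / c \<theta> * (d \<theta> - c \<theta>)) (at \<theta> within {a..u})"
    by (rule has_field_derivative_transform_within[OF _ zero_less_one])
      (use \<theta> K in auto)
qed

lemma pb_d_deriv_top:
  assumes "0 \<le> a" "0 < c a" "a \<le> \<theta>" "\<theta> < tp"
  shows "(d has_real_derivative dP \<theta> / c \<theta> * (d \<theta> - c \<theta>)) (at \<theta> within {a..tp})"
proof -
  obtain u where u: "\<theta> < u" "u < tp" using dense[OF assms(4)] by blast
  have "at \<theta> within {a..tp} = at \<theta> within {a..u}"
    by (rule at_within_nhd[of _ "{..<u}"]) (use u in auto)
  then show ?thesis
    using pb_d_deriv[of a \<theta> u] assms u by simp
qed

lemma pb_d_cont:
  assumes "0 \<le> a" "0 < c a" "a < tp"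
  shows "continuous_on {a..tp} d"
  unfolding continuous_on_eq_continuous_within
proof
  fix x assume x: "x \<in> {a..tp}"
  show "continuous (at x within {a..tp}) d"
  proof (cases "x = tp")
    case True
    then show ?thesis
      using pb_d_tendsto_top[OF assms(1,3,2)] assms(3)
      by (simp add: continuous_within at_within_Icc_at_left pb_d_top)
  next
    case False
    then show ?thesis
      using pb_d_deriv_top[OF assms(1,2), of x] x
      by (auto intro: has_field_derivative_imp_has_derivative has_derivative_continuous)
  qed
qed

lemma c_tendsto_top: "(c \<longlongrightarrow> c tp) (at_left tp)"
proof -
  have "(c \<longlongrightarrow> c tp) (at tp within {0..tp})"
    using continuous_on_subset[OF cont_c, of "{0..tp}"] top by (auto simp: continuous_on)
  then show ?thesis using top by (simp add: at_within_Icc_at_left)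
qed

text \<open>Lets a comparison start from the boundary value at \<open>tp\<close> although the
  equation may be singular there. The factor \<open>k\<close> depends on \<open>u\<close>, but
  \<open>k \<le> 1\<close> gives \<open>k * f u \<le> max 0 (f u)\<close>, and the right side tends
  to \<open>max 0 l = 0\<close>.\<close>

lemma le_zero_by_limit:
  assumes "\<theta> < tp" and "\<And>u. \<theta> < u \<Longrightarrow> u < tp \<Longrightarrow> \<exists>k. 0 < k \<and> k \<le> 1 \<and> x \<le> k * f u"
    and "(f \<longlongrightarrow> l) (at_left tp)" "l \<le> 0"
  shows "x \<le> (0::real)"
proof -
  have "x \<le> max 0 l"
  proof (rule tendsto_lowerbound)
    show "((\<lambda>u. max 0 (f u)) \<longlongrightarrow> max 0 l) (at_left tp)"
      by (intro tendsto_intros assms)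
    show "eventually (\<lambda>u. x \<le> max 0 (f u)) (at_left tp)"
      using eventually_at_left_real[OF assms(1)]
    proof eventually_elim
      case (elim u)
      then obtain k where k: "0 < k" "k \<le> 1" "x \<le> k * f u" using assms(2) by auto
      moreover have "k * f u \<le> max 0 (f u)"
        using k mult_right_mono[of k 1 "f u"] mult_nonneg_nonpos[of k "f u"] by (cases "0 \<le> f u") auto
      ultimately show ?case by simp
    qed
  qed simp
  then show ?thesis using assms(4) by simp
qed

section \<open>Comparing the deviation with zero and with the bias\<close>

lemma rate_nonneg:
  assumes "0 \<le> a" "0 < c a" "a \<le> t" "t < tp"
  shows "0 \<le> dP t / c t"
  using c_pos_right[OF assms(1-3)] assms dP_nonneg[of t] top by auto

lemma deriv_c_sub: "0 \<le> a \<Longrightarrow> u \<le> 1 \<Longrightarrow> t \<in> {a..u} \<Longrightarrow> (c has_real_derivative dA t - dP t) (at t within {a..u})"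
  by (rule DERIV_subset[OF deriv_c]) auto

text \<open>\<open>- d\<close> solves the comparison equation with source \<open>dP\<close>, and its
  limit at \<open>tp\<close> is \<open>- c tp / 2\<close>.\<close>

lemma pb_d_nonneg:
  assumes "0 \<le> \<theta>" "\<theta> \<le> tp" "0 < c \<theta> \<or> \<theta> = tp"
  shows "0 \<le> d \<theta>"
proof (cases "\<theta> = tp")
  case True
  then show ?thesis using top bias_nonneg[of tp] by (simp add: pb_d_top)
next
  case False
  with assms have \<theta>: "\<theta> < tp" "0 < c \<theta>" by auto
  have "- d \<theta> \<le> 0"
  proof (rule le_zero_by_limit[OF \<theta>(1)])
    show "((\<lambda>u. - d u) \<longlongrightarrow> - (c tp / 2)) (at_left tp)"
      by (intro tendsto_intros pb_d_tendsto_top[OF assms(1) \<theta>])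
    show "- (c tp / 2) \<le> 0" using bias_nonneg[of tp] top by simp
    fix u assume u: "\<theta> < u" "u < tp"
    show "\<exists>k>0. k \<le> 1 \<and> - d \<theta> \<le> k * - d u"
    proof (rule ode_compare[of \<theta> u "\<lambda>t. dP t / c t" dP "\<lambda>t. - d t"])
      show "continuous_on {\<theta>..u} (\<lambda>t. dP t / c t)"
        by (rule cont_rate[OF assms(1) \<theta>(2) _ cont_dP]) (use u in auto)
      fix t assume t: "t \<in> {\<theta>..u}"
      show "((\<lambda>t. - d t) has_real_derivative dP t / c t * - d t + dP t) (at t within {\<theta>..u})"
        using c_pos_right[OF assms(1) \<theta>(2), of t] t u
        by (auto intro!: derivative_eq_intros pb_d_deriv assms \<theta> simp: field_simps)
    qed (use u assms top dP_nonneg rate_nonneg[OF assms(1) \<theta>(2)] in auto)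
  qed
  then show ?thesis by simp
qed

text \<open>\<open>d - c\<close> solves the comparison equation with source \<open>- c'\<close>,
  which is nonnegative for decreasing bias. The sign therefore travels backwards from the limit
  \<open>- c tp / 2\<close> at the top.\<close>

lemma pb_d_le_c_antimono:
  assumes "antimono_on Theta c" "0 \<le> \<theta>" "\<theta> < tp" "0 < c \<theta>"
  shows "d \<theta> \<le> c \<theta>"
proof -
  have dc: "dA t - dP t \<le> 0" if "t \<in> Theta" for t
  proof -
    have "0 \<le> - (dA t - dP t)"
    proof (rule has_real_derivative_nonneg_of_mono_on)
      show "mono_on Theta (\<lambda>t. - c t)"
        using assms(1) by (auto simp: monotone_on_def)
      show "((\<lambda>t. - c t) has_real_derivative - (dA t - dP t)) (at t within Theta)"
        by (intro derivative_intros deriv_c that)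
      show "t islimpt Theta"
        by (rule connected_imp_perfect[OF _ that]) auto
    qed fact
    then show ?thesis by simp
  qed
  have "d \<theta> - c \<theta> \<le> 0"
  proof (rule le_zero_by_limit[OF assms(3)])
    show "((\<lambda>u. d u - c u) \<longlongrightarrow> c tp / 2 - c tp) (at_left tp)"
      by (intro tendsto_intros pb_d_tendsto_top[OF assms(2-4)] c_tendsto_top)
    show "c tp / 2 - c tp \<le> 0" using bias_nonneg[of tp] top by simp
    fix u assume u: "\<theta> < u" "u < tp"
    show "\<exists>k>0. k \<le> 1 \<and> d \<theta> - c \<theta> \<le> k * (d u - c u)"
    proof (rule ode_compare[of \<theta> u "\<lambda>t. dP t / c t" "\<lambda>t. - (dA t - dP t)" "\<lambda>t. d t - c t"])
      show "continuous_on {\<theta>..u} (\<lambda>t. dP t / c t)"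
        by (rule cont_rate[OF assms(2,4) _ cont_dP]) (use u in auto)
      fix t assume t: "t \<in> {\<theta>..u}"
      show "((\<lambda>t. d t - c t) has_real_derivative dP t / c t * (d t - c t) + - (dA t - dP t)) (at t within {\<theta>..u})"
        using t u assms top
        by (auto intro!: derivative_eq_intros pb_d_deriv deriv_c_sub)
    next
      fix t assume t: "t \<in> {\<theta>..u}"
      show "0 \<le> - (dA t - dP t)" using dc[of t] t u assms top by auto
    qed (use u assms top rate_nonneg[OF assms(2,4)] in auto)
  qed
  then show ?thesis by simp
qed

text \<open>For increasing bias the roles are reversed: \<open>c - d\<close> has the source
  \<open>c'\<close>, so \<open>d \<le> c\<close> travels forwards. The set that defines
  \<open>bt\<close> is then closed upwards below \<open>tp\<close>.\<close>

lemma pb_d_le_c_mono: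
  assumes "mono_on Theta c" "0 \<le> \<theta>" "0 < c \<theta>" "d \<theta> \<le> c \<theta>" "\<theta> \<le> u" "u < tp"
  shows "d u \<le> c u"
proof -
  have dc: "0 \<le> dA t - dP t" if "t \<in> Theta" for t
  proof (rule has_real_derivative_nonneg_of_mono_on[OF assms(1) that _ deriv_c[OF that]])
    show "t islimpt Theta"
      by (rule connected_imp_perfect[OF _ that]) auto
  qed
  obtain k where "0 < k" "k \<le> 1" "c \<theta> - d \<theta> \<le> k * (c u - d u)"
  proof (rule ode_compare[of \<theta> u "\<lambda>t. dP t / c t" "\<lambda>t. dA t - dP t" "\<lambda>t. c t - d t"])
    show "continuous_on {\<theta>..u} (\<lambda>t. dP t / c t)"
      by (rule cont_rate[OF assms(2,3) _ cont_dP]) (use assms in auto)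
    fix t assume t: "t \<in> {\<theta>..u}"
    show "((\<lambda>t. c t - d t) has_real_derivative dP t / c t * (c t - d t) + (dA t - dP t)) (at t within {\<theta>..u})"
      using t assms top
      by (auto intro!: derivative_eq_intros pb_d_deriv deriv_c_sub simp: algebra_simps)
  next
    fix t assume t: "t \<in> {\<theta>..u}"
    show "0 \<le> dA t - dP t" using dc[of t] t assms top by auto
  qed (use assms top rate_nonneg[OF assms(2,3)] in auto)
  then show ?thesis using assms(4) zero_le_mult_iff[of k "c u - d u"] by linarith
qed

lemma pb_d_antimono:
  assumes "0 \<le> a" "0 < c a" "a \<le> x" "x \<le> y" "y \<le> tp"
    and le: "\<And>t. a < t \<Longrightarrow> t < tp \<Longrightarrow> d t \<le> c t"
  shows "d y \<le> d x"
proof (cases "x = y")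
  case False
  then have atp: "a < tp" using assms by simp
  have "- d x \<le> - d y"
  proof (rule DERIV_nonneg_imp_increasing_open[OF assms(4)])
    show "continuous_on {x..y} (\<lambda>t. - d t)"
      using continuous_on_subset[OF pb_d_cont[OF assms(1,2) atp]] assms by (intro continuous_intros) auto
    fix t assume t: "x < t" "t < y"
    then have t': "a < t" "t < tp" using assms by auto
    have "((\<lambda>t. - d t) has_real_derivative - (dP t / c t * (d t - c t))) (at t)"
      using pb_d_deriv_top[OF assms(1,2), of t] t' by (intro derivative_intros) (auto simp: at_within_Icc_at)
    moreover have "0 \<le> - (dP t / c t * (d t - c t))"
      using mult_nonneg_nonpos[of "dP t / c t" "d t - c t"] rate_nonneg[OF assms(1,2), of t] le[of t] t' by simp
    ultimately show "\<exists>y. ((\<lambda>t. - d t) has_real_derivative y) (at t) \<and> 0 \<le> y" by blast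
  qed
  then show ?thesis by simp
qed simp

text \<open>If \<open>c\<close> is decreasing, \<open>d \<le> c\<close> holds from the start and
  \<open>bt = 0\<close>. If \<open>c\<close> is increasing, \<open>bt\<close> is a genuine
  threshold, and continuity gives \<open>d bt = c bt\<close> unless it is \<open>0\<close>. Either
  way the lottery at \<open>bt\<close> joins the truthful region below without a jump, and there
  \<open>c\<close> is at most \<open>d bt\<close>.\<close>

lemma bot_facts:
  shows "0 \<le> bt" "bt < tp" "0 < c bt"
    and "\<And>\<theta>. bt \<le> \<theta> \<Longrightarrow> \<theta> \<le> tp \<Longrightarrow> d \<theta> \<le> c \<theta>"
    and "0 < bt \<Longrightarrow> d bt = c bt"
    and "\<And>\<theta>. 0 \<le> \<theta> \<Longrightarrow> \<theta> < bt \<Longrightarrow> c \<theta> \<le> d bt"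
proof -
  define D where "D = {\<theta> \<in> {0..tp}. c \<theta> > 0 \<and> d \<theta> \<le> c \<theta>}"
  have bt: "bt = Inf D" by (simp add: pb_bot_def D_def)
  have bdd: "bdd_below D" by (auto simp: D_def intro: bdd_belowI[of _ 0])
  have dc_top: "d tp \<le> c tp" using bias_nonneg[of tp] top by (simp add: pb_d_top)
  have main: "0 \<le> bt \<and> bt < tp \<and> 0 < c bt \<and> (\<forall>\<theta>. bt \<le> \<theta> \<longrightarrow> \<theta> \<le> tp \<longrightarrow> d \<theta> \<le> c \<theta>) \<and> (0 < bt \<longrightarrow> d bt = c bt)
    \<and> (\<forall>\<theta>. 0 \<le> \<theta> \<longrightarrow> \<theta> < bt \<longrightarrow> c \<theta> \<le> d bt)"
    using bias_mono
  proof
    assume anti: "antimono_on Theta c"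
    have c0: "0 < c 0"
    proof (rule ccontr)
      assume "\<not> 0 < c 0"
      then have "c 0 = 0" "c 1 = 0"
        using bias_nonneg[of 0] bias_nonneg[of 1] monotone_onD[OF anti, of 0 1] by auto
      then show False using bias_zero[of 0 1] by simp
    qed
    have "0 \<in> D" using c0 top pb_d_le_c_antimono[OF anti _ _ c0] by (auto simp: D_def)
    then have bt0: "bt = 0"
      unfolding bt by (intro antisym cInf_lower bdd cInf_greatest) (auto simp: D_def)
    have "d \<theta> \<le> c \<theta>" if "0 \<le> \<theta>" "\<theta> \<le> tp" for \<theta>
      using pb_d_le_c_antimono[OF anti that(1)] c_pos_right[OF _ c0, of \<theta>] that dc_top
      by (cases "\<theta> = tp") auto
    then show ?thesis using bt0 top c0 by auto
  next
    assume mono: "mono_on Theta c"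
    have c1: "0 < c 1"
    proof (rule ccontr)
      assume "\<not> 0 < c 1"
      then have "c 0 = 0" "c 1 = 0"
        using bias_nonneg[of 0] bias_nonneg[of 1] mono_onD[OF mono, of 0 1] by auto
      then show False using bias_zero[of 0 1] by simp
    qed
    then have ctp: "0 < c tp" using c_top_zero bias_nonneg[of tp] top by (auto simp: less_le)
    have cpos: "0 < c t" if "0 < t" "t \<le> tp" for t
      using that c_pos[of t] c1 top by (cases "t = 1") auto
    \<comment> \<open>Since \<open>d - c\<close> tends to \<open>- c tp / 2 < 0\<close>, points just
      below \<open>tp\<close> belong to \<open>D\<close>; this gives \<open>bt < tp\<close>.\<close>
    have "eventually (\<lambda>u. d u - c u < 0) (at_left tp)"
    proof (rule order_tendstoD)
      show "((\<lambda>u. d u - c u) \<longlongrightarrow> c tp / 2 - c tp) (at_left tp)"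
        by (intro tendsto_intros pb_d_tendsto_top[of "tp/2"] c_tendsto_top) (use top cpos in auto)
    qed (use ctp in auto)
    then have "eventually (\<lambda>u. d u - c u < 0 \<and> u \<in> {0<..<tp}) (at_left tp)"
      using eventually_at_left_real[OF top(1)] by (rule eventually_conj)
    then obtain u where u: "d u < c u" "0 < u" "u < tp"
      using eventually_happens[of _ "at_left tp"] by (force simp: trivial_limit_at_left_real)
    have uD: "u \<in> D" using u cpos by (auto simp: D_def)
    then have Dne: "D \<noteq> {}" by auto
    have bt_tp: "bt < tp" using cInf_lower[OF uD bdd] u by (simp add: bt)
    have bt0: "0 \<le> bt" unfolding bt by (rule cInf_greatest[OF Dne]) (auto simp: D_def)
    have right: "d \<theta> \<le> c \<theta>" if "bt < \<theta>" "\<theta> \<le> tp" for \<theta>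
    proof (cases "\<theta> = tp")
      case False
      obtain x where "x \<in> D" "x < \<theta>"
        using cInf_lessD[OF Dne, of \<theta>] \<open>bt < \<theta>\<close> by (auto simp: bt)
      then show ?thesis
        using pb_d_le_c_mono[OF mono, of x \<theta>] that False by (auto simp: D_def)
    qed (use dc_top in simp)
    \<comment> \<open>The infimum could a priori be a zero of \<open>c\<close> at \<open>0\<close>.
      But to the right of \<open>bt = 0\<close> the deviation is decreasing and at most
      \<open>c\<close>, so \<open>c t \<ge> d t \<ge> d tp = c tp / 2\<close>, a positive bound that
      persists in the limit.\<close>
    have cbt: "0 < c bt"
    proof (cases "bt = 0")
      case True
      have "c tp / 2 \<le> c t" if "0 < t" "t < tp" for t
      proof -
        have "d tp \<le> d t"
          using that cpos[of t] right True by (intro pb_d_antimono[of t]) auto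
        then show ?thesis using right[of t] that True by (simp add: pb_d_top)
      qed
      moreover have "(c \<longlongrightarrow> c 0) (at_right 0)"
        using continuous_on_Icc_at_rightD[OF cont_c] by simp
      ultimately have "c tp / 2 \<le> c 0"
        using eventually_at_right_real[OF top(1)]
        by (intro tendsto_lowerbound[of c]) (auto elim!: eventually_mono)
      then show ?thesis using ctp True by simp
    qed (use bt0 cpos bt_tp in auto)
    have cont: "continuous_on {a..tp} (\<lambda>t. c t - d t)" if "0 \<le> a" "a < tp" "0 < c a" for a
      by (intro continuous_intros continuous_on_subset[OF cont_c] pb_d_cont that) (use that top in auto)
    have dcbt: "d bt \<le> c bt"
    proof -
      have "((\<lambda>t. c t - d t) \<longlongrightarrow> c bt - d bt) (at_right bt)"
        using continuous_on_Icc_at_rightD[OF cont[OF bt0 bt_tp cbt] bt_tp] .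
      then have "0 \<le> c bt - d bt"
        using eventually_at_right_real[OF bt_tp] right
        by (intro tendsto_lowerbound[of _ "c bt - d bt"]) (auto elim!: eventually_mono)
      then show ?thesis by simp
    qed
    \<comment> \<open>Points just left of \<open>bt\<close> lie outside \<open>D\<close> although
      \<open>c\<close> is positive there, so \<open>d > c\<close> on that side; the right side has
      given \<open>d bt \<le> c bt\<close>.\<close>
    have eq: "d bt = c bt" if "0 < bt"
    proof -
      have "continuous_on {bt/2..bt} (\<lambda>t. c t - d t)"
        using continuous_on_subset[OF cont[of "bt/2"]] that bt_tp cpos[of "bt/2"] by auto
      from continuous_on_Icc_at_leftD[OF this]
      have lim: "((\<lambda>t. c t - d t) \<longlongrightarrow> c bt - d bt) (at_left bt)" using that by simp
      have "eventually (\<lambda>t. c t - d t \<le> 0) (at_left bt)"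
        using eventually_at_left_real[OF that]
      proof eventually_elim
        case (elim t)
        then have "t \<notin> D" using cInf_lower[OF _ bdd, of t] by (auto simp: bt)
        then show ?case using elim bt_tp cpos[of t] by (auto simp: D_def)
      qed
      then have "c bt - d bt \<le> 0"
        by (intro tendsto_upperbound[OF lim]) auto
      then show ?thesis using dcbt by simp
    qed
    have "c \<theta> \<le> d bt" if "0 \<le> \<theta>" "\<theta> < bt" for \<theta>
      using mono_onD[OF mono, of \<theta> bt] eq that bt_tp top by auto
    then show ?thesis
      using bt0 bt_tp cbt eq dcbt right by (auto simp: le_less)
  qed
  then show "0 \<le> bt" "bt < tp" "0 < c bt" "\<And>\<theta>. bt \<le> \<theta> \<Longrightarrow> \<theta> \<le> tp \<Longrightarrow> d \<theta> \<le> c \<theta>"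
    "0 < bt \<Longrightarrow> d bt = c bt" "\<And>\<theta>. 0 \<le> \<theta> \<Longrightarrow> \<theta> < bt \<Longrightarrow> c \<theta> \<le> d bt"
    by blast+
qed

end

section \<open>Moments of mechanisms\<close>

text \<open>The raw second moment replaces the variance because quadratic payoffs are affine in mean
  and second moment; incentive constraints become linear in this pair.\<close>

definition mech_second :: "(real \<Rightarrow> real measure) \<Rightarrow> real \<Rightarrow> real" where
  "mech_second m \<theta> = (LINT a|m \<theta>. a\<^sup>2)"

lemma mechanismD:
  assumes "mechanism A m" "\<theta> \<in> Theta"
  shows "prob_space (m \<theta>)" "sets (m \<theta>) = sets (restrict_space borel A)" "space (m \<theta>) = A"
proof -
  have "m \<theta> \<in> space (prob_algebra (restrict_space borel A))"
    using measurable_space[OF assms(1)[unfolded mechanism_def]] assms(2)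
    by (simp add: space_restrict_space)
  then show "prob_space (m \<theta>)" and *: "sets (m \<theta>) = sets (restrict_space borel A)"
    by (auto simp: space_prob_algebra)
  show "space (m \<theta>) = A" using sets_eq_imp_space_eq[OF *] by (simp add: space_restrict_space)
qed

lemma mechanism_integrable:
  fixes f :: "real \<Rightarrow> real"
  assumes m: "mechanism A m" "\<theta> \<in> Theta" and f: "f \<in> borel_measurable borel"
    and bd: "\<And>a. a \<in> A \<Longrightarrow> \<bar>f a\<bar> \<le> C"
  shows "integrable (m \<theta>) f"
proof -
  interpret prob_space "m \<theta>" using mechanismD(1)[OF m] .
  have "f \<in> borel_measurable (m \<theta>)"
    using measurable_restrict_space1[OF f] mechanismD(2)[OF m] by (simp cong: measurable_cong_sets)
  then show ?thesis
    using bd mechanismD(3)[OF m] by (intro integrable_const_bound[of _ C]) auto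
qed

lemma mechanism_moments:
  assumes m: "mechanism A m" "\<theta> \<in> Theta" and "A \<subseteq> {-B..B}"
  shows mech_var_eq: "mech_var m \<theta> = mech_second m \<theta> - (mech_mean m \<theta>)\<^sup>2"
    and mech_var_nonneg: "(mech_mean m \<theta>)\<^sup>2 \<le> mech_second m \<theta>"
    and mech_mean_bound: "\<bar>mech_mean m \<theta>\<bar> \<le> B"
    and mech_second_bound: "\<bar>mech_second m \<theta>\<bar> \<le> B\<^sup>2"
    and payoff_eq: "payoff y m \<theta>' \<theta> = 2 * y \<theta>' * mech_mean m \<theta> - mech_second m \<theta> - (y \<theta>')\<^sup>2"
proof -
  interpret prob_space "m \<theta>" using mechanismD(1)[OF m] .
  have abs: "\<bar>a\<bar> \<le> B" if "a \<in> A" for a using subsetD[OF assms(3) that] by (auto simp: abs_le_iff)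
  have sq: "a\<^sup>2 \<le> B\<^sup>2" if "a \<in> A" for a
    using power_mono[OF abs[OF that], of 2] by simp
  have i1: "integrable (m \<theta>) (\<lambda>a. a)"
    by (rule mechanism_integrable[OF m, of _ B]) (use abs in auto)
  have i2: "integrable (m \<theta>) (\<lambda>a. a\<^sup>2)"
    by (rule mechanism_integrable[OF m, of _ "B\<^sup>2"]) (use sq in auto)
  have expand: "(LINT a|m \<theta>. (a - x)\<^sup>2) = mech_second m \<theta> - 2 * x * mech_mean m \<theta> + x\<^sup>2" for x
  proof -
    have "(LINT a|m \<theta>. (a - x)\<^sup>2) = (LINT a|m \<theta>. a\<^sup>2 - 2 * x * a + x\<^sup>2)"
      by (intro Bochner_Integration.integral_cong) (auto simp: power2_eq_square algebra_simps)
    then show ?thesis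
      using i1 i2 by (simp add: mech_second_def mech_mean_def prob_space)
  qed
  show v: "mech_var m \<theta> = mech_second m \<theta> - (mech_mean m \<theta>)\<^sup>2"
    unfolding mech_var_def expand by (simp add: power2_eq_square)
  have "0 \<le> mech_var m \<theta>" by (simp add: mech_var_def)
  then show "(mech_mean m \<theta>)\<^sup>2 \<le> mech_second m \<theta>" using v by simp
  show "payoff y m \<theta>' \<theta> = 2 * y \<theta>' * mech_mean m \<theta> - mech_second m \<theta> - (y \<theta>')\<^sup>2"
    unfolding payoff_def expand by simp
  have "mech_mean m \<theta> \<le> B"
    unfolding mech_mean_def by (rule integral_le_const[OF i1]) (use abs mechanismD(3)[OF m] in force)
  moreover have "- B \<le> mech_mean m \<theta>"
    unfolding mech_mean_def by (rule integral_ge_const[OF i1]) (use abs mechanismD(3)[OF m] in force)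
  ultimately show "\<bar>mech_mean m \<theta>\<bar> \<le> B" by simp
  have "mech_second m \<theta> \<le> B\<^sup>2"
    unfolding mech_second_def by (rule integral_le_const[OF i2]) (use sq mechanismD(3)[OF m] in force)
  moreover have "0 \<le> mech_second m \<theta>"
    by (simp add: mech_second_def)
  ultimately show "\<bar>mech_second m \<theta>\<bar> \<le> B\<^sup>2" by simp
qed

lemma mechanism_measurable:
  assumes "mechanism A m"
  shows "mech_mean m \<in> borel_measurable (restrict_space borel Theta)"
    and "mech_second m \<in> borel_measurable (restrict_space borel Theta)"
proof -
  have *: "(\<lambda>\<theta>. LINT a|m \<theta>. f a) \<in> borel_measurable (restrict_space borel Theta)"
    if "f \<in> borel_measurable borel" for f :: "real \<Rightarrow> real"
    using measurable_compose[OF measurable_prob_algebraD[OF assms[unfolded mechanism_def]]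
        integral_measurable_subprob_algebra[OF measurable_restrict_space1[OF that]]] by simp
  show "mech_mean m \<in> borel_measurable (restrict_space borel Theta)"
    using *[of "\<lambda>a. a"] by (simp add: mech_mean_def[abs_def])
  show "mech_second m \<in> borel_measurable (restrict_space borel Theta)"
    using *[of "\<lambda>a. a\<^sup>2"] by (simp add: mech_second_def[abs_def])
qed

lemma IC_mechanisms_iff:
  assumes "A \<subseteq> {-B..B}"
  shows "m \<in> IC_mechanisms A y \<longleftrightarrow> mechanism A m \<and> (\<forall>\<theta>\<in>Theta. \<forall>\<theta>'\<in>Theta.
    2 * y \<theta> * (mech_mean m \<theta>' - mech_mean m \<theta>) \<le> mech_second m \<theta>' - mech_second m \<theta>)"
  unfolding IC_mechanisms_def
  by (auto simp: payoff_eq[OF _ _ assms] algebra_simps)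

section \<open>The saddle mechanism\<close>

context positive_bias
begin

text \<open>The boundary value \<open>d tp = c tp / 2\<close> makes the mean continuous where
  pooling begins.\<close>

lemma mu_top: "pb_mean zP zA tp = (zP tp + zP 1) / 2"
  using bot_facts(2) by (simp add: pb_mean_def pb_d_top c_top field_simps)

text \<open>The two bounds are the incentive constraints between \<open>x\<close> and
  \<open>y\<close> in both directions. Local constraints chain because \<open>zA\<close> is
  increasing, so it suffices to check them on \<open>[0, bt]\<close>, \<open>[bt, tp]\<close> and
  \<open>[tp, 1]\<close>.\<close>

lemma pb_moments_chain:
  fixes s
  defines "s \<equiv> \<lambda>\<theta>. pb_var zP zA \<theta> + (pb_mean zP zA \<theta>)\<^sup>2"
  assumes "0 \<le> x" "x \<le> y" "y \<le> 1"
  shows "2 * zA x * (pb_mean zP zA y - pb_mean zP zA x) \<le> s y - s x"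
    and "s y - s x \<le> 2 * zA y * (pb_mean zP zA y - pb_mean zP zA x)"
proof -
  let ?m = "pb_mean zP zA"
  \<comment> \<open>Monotonicity of the mean is part of \<open>ch\<close> because transitivity rests
    on the sign of products such as \<open>(zA y - zA x) * (?m z - ?m y)\<close>.\<close>
  define ch where "ch x y \<longleftrightarrow> ?m x \<le> ?m y \<and> 2 * zA x * (?m y - ?m x) \<le> s y - s x
      \<and> s y - s x \<le> 2 * zA y * (?m y - ?m x)" for x y
  have ch_trans: "ch x z" if "ch x y" "ch y z" "0 \<le> x" "x \<le> y" "y \<le> z" "z \<le> 1" for x y z
  proof -
    have z: "zA x \<le> zA y" "zA y \<le> zA z" using that by (auto intro: zA_le)
    have "0 \<le> (zA y - zA x) * (?m z - ?m y)" "0 \<le> (zA z - zA y) * (?m y - ?m x)"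
      using z that by (auto simp: ch_def)
    then show ?thesis using that(1,2) by (auto simp: ch_def algebra_simps)
  qed
  note bot = bot_facts
  \<comment> \<open>At \<open>\<theta> = bt\<close> the middle formula is already in force; there
    \<open>d bt = c bt\<close> turns \<open>zP bt + d bt\<close> into \<open>zA bt\<close>.\<close>
  have low: "?m \<theta> = zA \<theta> \<and> s \<theta> = (zA \<theta>)\<^sup>2" if "0 \<le> \<theta>" "\<theta> \<le> bt" "0 < bt" for \<theta>
    using that bot by (cases "\<theta> = bt") (auto simp: s_def pb_mean_def pb_var_def pb_c_def)
  have mid: "?m \<theta> = zP \<theta> + d \<theta> \<and> s \<theta> = (d bt)\<^sup>2 + (zP \<theta>)\<^sup>2 + 2 * zP \<theta> * d \<theta>" if "bt \<le> \<theta>" "\<theta> \<le> tp" for \<theta>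
    using that by (auto simp: s_def pb_mean_def pb_var_def power2_eq_square algebra_simps)
  have high: "?m \<theta> = ?m tp \<and> s \<theta> = s tp" if "tp \<le> \<theta>" "\<theta> \<le> 1" for \<theta>
  proof (cases "\<theta> = tp")
    case False
    have zP1: "zP 1 = zP tp + c tp" by (simp add: c_top)
    show ?thesis
      using that bot False mu_top
      by (simp add: s_def pb_var_def pb_mean_def pb_d_top zP1 power2_eq_square field_simps)
  qed simp
  have ch_low: "ch x y" if "0 \<le> x" "x \<le> y" "y \<le> bt" for x y
  proof (cases "x = y")
    case False
    have *: "0 \<le> zA y - zA x" using that bot top by (auto intro: zA_le)
    then have "0 \<le> (zA y - zA x) * (zA y - zA x)" by simp
    with * show ?thesis
      using low[of x] low[of y] that False by (auto simp: ch_def power2_eq_square algebra_simps)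
  qed (simp add: ch_def)
  have ch_mid: "ch x y" if xy: "bt \<le> x" "x \<le> y" "y \<le> tp" for x y
  proof (cases "x = y")
    case False
    \<comment> \<open>The equation for \<open>d\<close> gives \<open>\<mu>' = dP * d / c\<close>,
      which is nonnegative, and this same factor times \<open>2 zA\<close> is the derivative of the
      second moment.\<close>
    have D: "((\<lambda>t. zP t + d t) has_real_derivative dP t * d t / c t) (at t)"
      "((\<lambda>t. (d bt)\<^sup>2 + (zP t)\<^sup>2 + 2 * zP t * d t) has_real_derivative 2 * zA t * (dP t * d t / c t)) (at t)"
      "0 \<le> dP t * d t / c t" if "x < t" "t < y" for t
    proof -
      have t: "bt < t" "t < tp" "0 < t" "t < 1" using that xy bot top by auto
      have cp: "0 < c t" using c_pos t by simp
      have dd: "(d has_real_derivative dP t / c t * (d t - c t)) (at t)"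
        using pb_d_deriv_top[OF bot(1,3), of t] t by (simp add: at_within_Icc_at)
      have dz: "(zP has_real_derivative dP t) (at t)"
        using deriv_P[of t] t by (simp add: at_within_Icc_at)
      show "((\<lambda>t. zP t + d t) has_real_derivative dP t * d t / c t) (at t)"
        by (rule derivative_eq_intros dd dz refl)+ (use cp in \<open>simp add: field_simps\<close>)
      have zAeq: "zA t = zP t + c t" by (simp add: pb_c_def)
      show "((\<lambda>t. (d bt)\<^sup>2 + (zP t)\<^sup>2 + 2 * zP t * d t) has_real_derivative 2 * zA t * (dP t * d t / c t)) (at t)"
        by (rule derivative_eq_intros dd dz refl)+ (use cp zAeq in \<open>simp add: field_simps\<close>)
      show "0 \<le> dP t * d t / c t"
        using cp pb_d_nonneg[of t] dP_nonneg[of t] t by simp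
    qed
    have cont: "continuous_on {x..y} d" "continuous_on {x..y} zP"
      using bot xy top
      by (auto intro!: continuous_on_subset[OF pb_d_cont[OF bot(1,3,2)]] continuous_on_subset[OF cont_P])
    have 1: "zP x + d x \<le> zP y + d y"
      by (rule DERIV_nonneg_imp_increasing_open[OF xy(2)])
        (use D in \<open>auto intro!: continuous_intros cont\<close>)
    define S where "S t = (d bt)\<^sup>2 + (zP t)\<^sup>2 + 2 * zP t * d t" for t
    have S: "continuous_on {x..y} S" "\<And>t. x < t \<Longrightarrow> t < y \<Longrightarrow> (S has_real_derivative 2 * zA t * (dP t * d t / c t)) (at t)"
      unfolding S_def[abs_def] using D by (auto intro!: continuous_intros cont)
    \<comment> \<open>With \<open>zA x\<close> frozen, the derivative at \<open>t\<close> is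
      \<open>2 (zA t - zA x) \<mu>'\<close>, nonnegative to the right of \<open>x\<close>. The next
      claim freezes \<open>zA y\<close> instead.\<close>
    have 2: "S x - 2 * zA x * (zP x + d x) \<le> S y - 2 * zA x * (zP y + d y)"
    proof (rule DERIV_nonneg_imp_increasing_open[OF xy(2)])
      show "continuous_on {x..y} (\<lambda>t. S t - 2 * zA x * (zP t + d t))"
        by (intro continuous_intros S cont)
      fix t assume t: "x < t" "t < y"
      have "zA x \<le> zA t" using t bot xy top by (intro zA_le) auto
      then have "0 \<le> 2 * zA t * (dP t * d t / c t) - 2 * zA x * (dP t * d t / c t)"
        using D(3)[OF t] mult_right_mono[of "2 * zA x" "2 * zA t" "dP t * d t / c t"] by linarith
      moreover have "((\<lambda>t. S t - 2 * zA x * (zP t + d t)) has_real_derivative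
        2 * zA t * (dP t * d t / c t) - 2 * zA x * (dP t * d t / c t)) (at t)"
        by (intro derivative_intros DERIV_cmult S D t)
      ultimately show "\<exists>z. ((\<lambda>t. S t - 2 * zA x * (zP t + d t)) has_real_derivative z) (at t) \<and> 0 \<le> z"
        by blast
    qed
    have 3: "2 * zA y * (zP x + d x) - S x \<le> 2 * zA y * (zP y + d y) - S y"
    proof (rule DERIV_nonneg_imp_increasing_open[OF xy(2)])
      show "continuous_on {x..y} (\<lambda>t. 2 * zA y * (zP t + d t) - S t)"
        by (intro continuous_intros S cont)
      fix t assume t: "x < t" "t < y"
      have "zA t \<le> zA y" using t bot xy top by (intro zA_le) auto
      then have "0 \<le> 2 * zA y * (dP t * d t / c t) - 2 * zA t * (dP t * d t / c t)"
        using D(3)[OF t] mult_right_mono[of "2 * zA t" "2 * zA y" "dP t * d t / c t"] by linarith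
      moreover have "((\<lambda>t. 2 * zA y * (zP t + d t) - S t) has_real_derivative
        2 * zA y * (dP t * d t / c t) - 2 * zA t * (dP t * d t / c t)) (at t)"
        by (intro derivative_intros DERIV_cmult S D t)
      ultimately show "\<exists>z. ((\<lambda>t. 2 * zA y * (zP t + d t) - S t) has_real_derivative z) (at t) \<and> 0 \<le> z"
        by blast
    qed
    show ?thesis
      using 1 2 3 mid[of x] mid[of y] xy by (auto simp: ch_def S_def algebra_simps)
  qed (simp add: ch_def)
  have ch_high: "ch x y" if "tp \<le> x" "x \<le> y" "y \<le> 1" for x y
    using high[of x] high[of y] that by (auto simp: ch_def)
  have ch_le_tp: "ch x y" if "0 \<le> x" "x \<le> y" "y \<le> tp" for x y
  proof -
    consider "y \<le> bt" | "bt \<le> x" | "x \<le> bt" "bt \<le> y" by linarith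
    then show ?thesis
      using that ch_low[of x y] ch_mid[of x y] ch_trans[OF ch_low[of x bt] ch_mid[of bt y]] top bot
      by cases auto
  qed
  have "ch x y"
  proof -
    consider "y \<le> tp" | "tp \<le> x" | "x \<le> tp" "tp \<le> y" by linarith
    then show ?thesis
      using assms ch_le_tp[of x y] ch_high[of x y] ch_trans[OF ch_le_tp[of x tp] ch_high[of tp y]] top bot
      by cases auto
  qed
  then show "2 * zA x * (?m y - ?m x) \<le> s y - s x" "s y - s x \<le> 2 * zA y * (?m y - ?m x)"
    by (auto simp: ch_def)
qed

lemma pb_mechanism_moments:
  assumes "pb_mechanism A zP zA m" "A \<subseteq> {-B..B}" "\<theta> \<in> Theta"
  shows "mech_mean m \<theta> = pb_mean zP zA \<theta>"
    and "mech_second m \<theta> = pb_var zP zA \<theta> + (pb_mean zP zA \<theta>)\<^sup>2"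
  using assms mech_var_eq[of A m \<theta> B] by (auto simp: pb_mechanism_def)

lemma pb_mechanism_IC:
  assumes "pb_mechanism A zP zA m" "A \<subseteq> {-B..B}"
  shows "m \<in> IC_mechanisms A zA"
  unfolding IC_mechanisms_iff[OF assms(2)]
proof (intro conjI ballI)
  show "mechanism A m" using assms(1) by (simp add: pb_mechanism_def)
  fix x y assume xy: "x \<in> Theta" "y \<in> Theta"
  show "2 * zA x * (mech_mean m y - mech_mean m x) \<le> mech_second m y - mech_second m x"
    unfolding pb_mechanism_moments[OF assms xy(1)] pb_mechanism_moments[OF assms xy(2)]
  proof (cases "x \<le> y")
    case True
    then show "2 * zA x * (pb_mean zP zA y - pb_mean zP zA x)
      \<le> pb_var zP zA y + (pb_mean zP zA y)\<^sup>2 - (pb_var zP zA x + (pb_mean zP zA x)\<^sup>2)"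
      using pb_moments_chain(1)[of x y] xy by auto
  next
    case False
    then show "2 * zA x * (pb_mean zP zA y - pb_mean zP zA x)
      \<le> pb_var zP zA y + (pb_mean zP zA y)\<^sup>2 - (pb_var zP zA x + (pb_mean zP zA x)\<^sup>2)"
      using pb_moments_chain(2)[of y x] xy by (auto simp: algebra_simps)
  qed
qed

text \<open>The loss is \<open>(\<mu> - zP)\<^sup>2\<close> plus the variance. Below
  \<open>bt\<close> it is \<open>c\<^sup>2\<close>; on \<open>[bt, tp]\<close> the variance is
  chosen to compensate \<open>d\<^sup>2\<close>; above \<open>tp\<close> the ideal action stays
  within \<open>c tp / 2\<close> of the pooled mean and is exactly that far away at type
  \<open>1\<close>, which is why the upper atom sits there.\<close>

lemma pb_mechanism_payoff:
  assumes m: "pb_mechanism A zP zA m" and A: "A \<subseteq> {-B..B}" and \<theta>: "\<theta> \<in> Theta"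
  shows "- (d bt)\<^sup>2 \<le> payoff zP m \<theta> \<theta>"
    and "bt \<le> \<theta> \<and> \<theta> \<le> tp \<or> \<theta> = 1 \<Longrightarrow> payoff zP m \<theta> \<theta> = - (d bt)\<^sup>2"
proof -
  note bot = bot_facts
  have mech: "mechanism A m" using m by (simp add: pb_mechanism_def)
  have eq: "payoff zP m \<theta> \<theta> = - (pb_mean zP zA \<theta> - zP \<theta>)\<^sup>2 - pb_var zP zA \<theta>"
    unfolding payoff_eq[OF mech \<theta> A] pb_mechanism_moments[OF m A \<theta>]
    by (simp add: power2_eq_square algebra_simps)
  have "- (d bt)\<^sup>2 \<le> payoff zP m \<theta> \<theta> \<and> (bt \<le> \<theta> \<and> \<theta> \<le> tp \<or> \<theta> = 1 \<longrightarrow> payoff zP m \<theta> \<theta> = - (d bt)\<^sup>2)"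
  proof -
    consider "\<theta> < bt" | "bt \<le> \<theta>" "\<theta> \<le> tp" | "tp < \<theta>" by linarith
    then show ?thesis
    proof cases
      case 1
      then have "(c \<theta>)\<^sup>2 \<le> (d bt)\<^sup>2"
        using bot(6)[of \<theta>] bias_nonneg[of \<theta>] \<theta> by (intro power_mono) auto
      then show ?thesis
        unfolding eq using 1 bot top by (auto simp: pb_mean_def pb_var_def pb_c_def)
    next
      case 2
      then show ?thesis unfolding eq by (auto simp: pb_mean_def pb_var_def)
    next
      case 3
      have "zP tp \<le> zP \<theta>" "zP \<theta> \<le> zP 1" using 3 \<theta> top by (auto intro: zP_le)
      then have "0 \<le> (zP \<theta> - zP tp) * (zP 1 - zP \<theta>)" by simp
      then have "((zP tp + zP 1) / 2 - zP \<theta>)\<^sup>2 \<le> (c tp)\<^sup>2 / 4"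
        by (simp add: c_top power2_eq_square field_simps)
      moreover have "((zP tp + zP 1) / 2 - zP \<theta>)\<^sup>2 = (c tp)\<^sup>2 / 4" if "\<theta> = 1"
        unfolding that by (simp add: c_top power2_eq_square field_simps)
      ultimately show ?thesis unfolding eq using 3 bot by (auto simp: pb_mean_def pb_var_def)
    qed
  qed
  then show "- (d bt)\<^sup>2 \<le> payoff zP m \<theta> \<theta>"
    "bt \<le> \<theta> \<and> \<theta> \<le> tp \<or> \<theta> = 1 \<Longrightarrow> payoff zP m \<theta> \<theta> = - (d bt)\<^sup>2" by auto
qed

end

section \<open>A distribution with two atoms and a density\<close>

text \<open>The sign of \<open>g\<close> yields integrability from the existence of the limits of
  \<open>G\<close> alone. This matters as \<open>g\<close> may be unbounded near \<open>tp\<close>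
  when \<open>c 1 = 0\<close>.\<close>

lemma integral_neg_derivative:
  fixes G g :: "real \<Rightarrow> real"
  assumes xy: "b \<le> x" "x < y" "y \<le> t" and cont: "continuous_on {b..t} G"
    and deriv: "\<And>u. b < u \<Longrightarrow> u < t \<Longrightarrow> (G has_real_derivative - g u) (at u)"
    and g: "\<And>u. b < u \<Longrightarrow> u < t \<Longrightarrow> isCont g u" "\<And>u. b < u \<Longrightarrow> u < t \<Longrightarrow> 0 \<le> g u"
  shows "set_integrable lborel {x<..<y} g" and "(LBINT u:{x<..<y}. g u) = G x - G y"
proof -
  have D: "((\<lambda>u. - G u) has_real_derivative g u) (at u)" if "b < u" "u < t" for u
    using DERIV_minus[OF deriv[OF that]] by simp
  have lim: "((\<lambda>u. - G u) \<longlongrightarrow> - G x) (at_right x)" "((\<lambda>u. - G u) \<longlongrightarrow> - G y) (at_left y)"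
    using continuous_on_Icc_at_rightD[OF continuous_on_subset[OF cont, of "{x..y}"] xy(2)]
      continuous_on_Icc_at_leftD[OF continuous_on_subset[OF cont, of "{x..y}"] xy(2)] xy
    by (auto intro!: tendsto_intros)
  note FTC = interval_integral_FTC_nonneg[of "ereal x" "ereal y" "\<lambda>u. - G u" g "- G x" "- G y"]
  have "set_integrable lborel (einterval x y) g" "(LBINT u=x..y. g u) = - G y - - G x"
    by (intro FTC; use xy D g lim in \<open>auto simp: ereal_tendsto_simps\<close>)+
  then show "set_integrable lborel {x<..<y} g" "(LBINT u:{x<..<y}. g u) = G x - G y"
    using xy by (auto simp: interval_integral_Ioo)
qed

lemma set_integrable_bounded_mult:
  fixes f g :: "real \<Rightarrow> real"
  assumes g: "set_integrable lborel S g" and f: "f \<in> borel_measurable borel" "\<And>x. x \<in> S \<Longrightarrow> \<bar>f x\<bar> \<le> C"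
  shows "set_integrable lborel S (\<lambda>x. f x * g x)"
  unfolding set_integrable_def
proof (rule Bochner_Integration.integrable_bound)
  show "integrable lborel (\<lambda>x. C * (indicat_real S x *\<^sub>R g x))"
    using g unfolding set_integrable_def by simp
  have "(\<lambda>x. f x * (indicator S x *\<^sub>R g x)) \<in> borel_measurable lborel"
    using g f unfolding set_integrable_def by (auto dest: borel_measurable_integrable)
  then show "(\<lambda>x. indicator S x *\<^sub>R (f x * g x)) \<in> borel_measurable lborel"
    by (simp add: algebra_simps)
  show "AE x in lborel. norm (indicat_real S x *\<^sub>R (f x * g x)) \<le> norm (C * (indicat_real S x *\<^sub>R g x))"
  proof (intro always_eventually allI)
    fix x
    show "norm (indicat_real S x *\<^sub>R (f x * g x)) \<le> norm (C * (indicat_real S x *\<^sub>R g x))"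
      using mult_right_mono[OF order_trans[OF f(2) abs_ge_self], of x "\<bar>g x\<bar>"]
      by (auto simp: indicator_def abs_mult)
  qed
qed

text \<open>The law is obtained as the image of an absolutely continuous one that spreads each atom over an
  interval of length one.\<close>

lemma real_distribution_two_atoms:
  fixes G g :: "real \<Rightarrow> real"
  assumes bt: "b < t" and cont: "continuous_on {b..t} G"
    and deriv: "\<And>u. b < u \<Longrightarrow> u < t \<Longrightarrow> (G has_real_derivative - g u) (at u)"
    and g: "\<And>u. b < u \<Longrightarrow> u < t \<Longrightarrow> isCont g u" "\<And>u. b < u \<Longrightarrow> u < t \<Longrightarrow> 0 \<le> g u"
    and G: "G b \<le> 1" "0 \<le> G t"
  obtains M where "real_distribution M"
    and "\<And>(f :: real \<Rightarrow> real) C. f \<in> borel_measurable borel \<Longrightarrow> (\<And>x. \<bar>f x\<bar> \<le> C) \<Longrightarrow>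
      (LINT x|M. f x) = (1 - G b) * f b + (LBINT x:{b<..<t}. f x * g x) + G t * f 1"
proof
  note g_int = integral_neg_derivative[OF order_refl bt order_refl cont deriv g]
  define h where "h x = (1 - G b) * indicat_real {b - 1..b} x + indicat_real {b<..<t} x *\<^sub>R g x
      + G t * indicat_real {t..t + 1} x" for x
  \<comment> \<open>The upper mass is sent to \<open>1\<close> and not to \<open>t\<close>, since
    the distribution has no mass strictly between \<open>tp\<close> and \<open>1\<close>.\<close>
  define p where "p x = (if x \<le> b then b else if x < t then x else 1)" for x :: real
  define M where "M = distr (density lborel (\<lambda>x. ennreal (h x))) borel p"
  have gi: "integrable lborel (\<lambda>x. indicat_real {b<..<t} x *\<^sub>R g x)"
    using g_int(1) by (simp add: set_integrable_def)
  have h_int: "integrable lborel h"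
    unfolding h_def[abs_def] using gi by simp
  have h_nonneg: "0 \<le> h x" for x
    using G g(2)[of x] by (auto simp: h_def indicator_def)
  have [measurable]: "h \<in> borel_measurable borel"
    using borel_measurable_integrable[OF h_int] by simp
  have [measurable]: "p \<in> borel_measurable borel"
    unfolding p_def[abs_def] by measurable
  have h1: "(LINT x|lborel. h x) = 1"
    unfolding h_def using gi g_int(2) by (simp add: set_lebesgue_integral_def)
  have "prob_space (density lborel (\<lambda>x. ennreal (h x)))"
  proof (rule prob_spaceI)
    have "(\<integral>\<^sup>+x. ennreal (h x) \<partial>lborel) = 1"
      using nn_integral_eq_integral[OF h_int] h_nonneg h1 by simp
    then show "emeasure (density lborel (\<lambda>x. ennreal (h x))) (space (density lborel (\<lambda>x. ennreal (h x)))) = 1"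
      by (simp add: emeasure_density)
  qed
  then show "real_distribution M"
    unfolding M_def real_distribution_def real_distribution_axioms_def
    by (auto intro!: prob_space.prob_space_distr)
  fix f :: "real \<Rightarrow> real" and C assume f[measurable]: "f \<in> borel_measurable borel" and bd: "\<And>x. \<bar>f x\<bar> \<le> C"
  have fg: "integrable lborel (\<lambda>x. indicat_real {b<..<t} x *\<^sub>R (f x * g x))"
    using set_integrable_bounded_mult[OF g_int(1) f bd] by (simp add: set_integrable_def)
  have "(LINT x|M. f x) = (LINT x|lborel. h x *\<^sub>R f (p x))"
    unfolding M_def using h_nonneg by (simp add: integral_distr integral_density)
  also have "\<dots> = (LINT x|lborel. ((1 - G b) * f b) * indicat_real {b - 1..b} x
      + indicat_real {b<..<t} x *\<^sub>R (f x * g x) + (G t * f 1) * indicat_real {t..t + 1} x)"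
    by (intro Bochner_Integration.integral_cong)
      (use bt in \<open>auto simp: h_def p_def indicator_def algebra_simps\<close>)
  also have "\<dots> = (1 - G b) * f b + (LBINT x:{b<..<t}. f x * g x) + G t * f 1"
    using fg by (simp add: set_lebesgue_integral_def)
  finally show "(LINT x|M. f x) = (1 - G b) * f b + (LBINT x:{b<..<t}. f x * g x) + G t * f 1" .
qed

text \<open>On a uniform partition the factors \<open>y - x\<close> are all equal and the increments
  of \<open>\<alpha>\<close> telescope, so the total is of order \<open>1 / n\<close>.
  \<open>\<alpha>\<close> may jump.\<close>

lemma eq_of_increment_bound:
  fixes f \<alpha> :: "real \<Rightarrow> real"
  assumes "a \<le> b" and inc: "\<And>x y. a \<le> x \<Longrightarrow> x \<le> y \<Longrightarrow> y \<le> b \<Longrightarrow> \<bar>f y - f x\<bar> \<le> (\<alpha> y - \<alpha> x) * (y - x)"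
  shows "f b = f a"
proof -
  have "\<bar>f b - f a\<bar> \<le> (\<alpha> b - \<alpha> a) * (b - a) / real (Suc n)" for n
  proof -
    define N where "N = real (Suc n)"
    have N: "N > 0" by (simp add: N_def)
    define x where "x i = a + real i * (b - a) / N" for i
    have xs: "x (Suc i) - x i = (b - a) / N" for i
      using N by (simp add: x_def field_simps)
    have x0: "x 0 = a" and xN: "x (Suc n) = b" using N by (auto simp: x_def N_def)
    have bound: "a \<le> x i \<and> x i \<le> x (Suc i) \<and> x (Suc i) \<le> b" if "i < Suc n" for i
    proof (intro conjI)
      show "a \<le> x i" using assms(1) N by (simp add: x_def)
      show "x i \<le> x (Suc i)" using xs[of i] assms(1) N by (smt (verit) divide_nonneg_nonneg)
      have "real (Suc i) \<le> N" using that by (simp add: N_def)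
      then have "real (Suc i) * (b - a) \<le> N * (b - a)"
        using assms(1) by (intro mult_right_mono) auto
      then show "x (Suc i) \<le> b" using N by (simp add: x_def field_simps)
    qed
    have "f b - f a = (\<Sum>i<Suc n. f (x (Suc i)) - f (x i))"
      by (subst sum_lessThan_telescope) (simp add: x0 xN)
    then have "\<bar>f b - f a\<bar> \<le> (\<Sum>i<Suc n. \<bar>f (x (Suc i)) - f (x i)\<bar>)"
      by (simp only: sum_abs)
    also have "\<dots> \<le> (\<Sum>i<Suc n. (\<alpha> (x (Suc i)) - \<alpha> (x i)) * ((b - a) / N))"
      using inc bound xs by (intro sum_mono) (metis lessThan_iff)
    also have "\<dots> = (\<alpha> b - \<alpha> a) * ((b - a) / N)"
      unfolding sum_distrib_right[symmetric] by (subst sum_lessThan_telescope) (simp add: x0 xN)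
    finally show ?thesis by (simp add: N_def)
  qed
  moreover have "(\<lambda>n. (\<alpha> b - \<alpha> a) * (b - a) / real (Suc n)) \<longlonglongrightarrow> 0"
    by (rule LIMSEQ_Suc[OF lim_const_over_n])
  ultimately have "\<bar>f b - f a\<bar> \<le> 0"
    by (intro LIMSEQ_le_const) auto
  then show ?thesis by simp
qed

section \<open>The saddle distribution\<close>

lemma interval_measure_cdf:
  assumes "real_distribution M"
  shows "interval_measure (cdf M) = M"
proof -
  interpret real_distribution M by fact
  have mono: "\<And>x y. x \<le> y \<Longrightarrow> cdf M x \<le> cdf M y" by (rule cdf_nondecreasing)
  show ?thesis
    using mono cdf_is_right_cont cdf_lim_at_bot cdf_lim_at_top_prob
    by (intro cdf_unique real_distribution_interval_measure cdf_interval_measure assms) auto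
qed

context positive_bias
begin

text \<open>\<open>G\<close> is \<open>1 - F\<^sup>*\<close> on \<open>[bt, tp)\<close>, extended to \<open>tp\<close> by its left limit (when \<open>c 1 = 0\<close> the
  integral in the definition of \<open>F\<^sup>*\<close> is improper at \<open>tp = 1\<close>).\<close>

definition pb_survival :: "(real \<Rightarrow> real) \<Rightarrow> bool" where
  "pb_survival G \<longleftrightarrow> continuous_on {bt..tp} G \<and> G bt = d bt / c bt \<and> (\<forall>u\<in>{bt..tp}. 0 \<le> G u) \<and>
    (\<forall>u\<in>{bt<..<tp}. (G has_real_derivative - (G u * dA u / c u)) (at u)) \<and>
    (\<forall>\<theta>. pb_cdf zP zA \<theta> = (if \<theta> < bt then 0 else if \<theta> < 1 then 1 - G (min \<theta> tp) else 1))"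

text \<open>\<open>E\<close> solves the linear equation below \<open>tp\<close>. In the improper
  case it is decreasing and nonnegative, so its left limit exists, and this limit is the mass of the
  atom at \<open>1\<close>.\<close>

lemma pb_survival_exists: "\<exists>G. pb_survival G"
proof -
  note bot = bot_facts
  define \<rho> where "\<rho> t = dA t / c t" for t
  define R where "R t = integral {bt..t} \<rho>" for t
  define E where "E t = d bt / c bt * exp (- R t)" for t
  have q: "0 \<le> d bt / c bt" using bot pb_d_nonneg[of bt] by simp
  have R_deriv: "(R has_real_derivative \<rho> t) (at t within {bt..u})"
    if "u < tp \<or> u = tp \<and> c 1 \<noteq> 0" "t \<in> {bt..u}" for t u
    unfolding R_def[abs_def] \<rho>_def[abs_def]
    by (rule integral_has_real_derivative[OF cont_rate[OF bot(1,3) that(1) cont_dA] that(2)])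
  have E_deriv: "(E has_real_derivative - (E t * \<rho> t)) (at t within {bt..u})"
    if "u < tp \<or> u = tp \<and> c 1 \<noteq> 0" "t \<in> {bt..u}" for t u
    unfolding E_def[abs_def]
    by (rule derivative_eq_intros R_deriv that refl)+ (simp add: algebra_simps)
  have E_nonneg: "0 \<le> E t" for t
    using mult_nonneg_nonneg[OF q, of "exp (- R t)"] by (simp add: E_def)
  have E_cont: "continuous_on {bt..u} E" if "u < tp \<or> u = tp \<and> c 1 \<noteq> 0" for u
    using E_deriv[OF that] by (rule DERIV_continuous_on)
  have E_deriv': "(E has_real_derivative - (E t * \<rho> t)) (at t)" if t: "bt < t" "t < tp" for t
  proof -
    obtain u where "t < u" "u < tp" using dense[OF t(2)] by blast
    then show ?thesis using E_deriv[of u t] t by (simp add: at_within_Icc_at)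
  qed
  obtain L where L: "(E \<longlongrightarrow> L) (at_left tp)" "c 1 \<noteq> 0 \<Longrightarrow> L = E tp"
  proof (cases "c 1 = 0")
    case False
    then show ?thesis using continuous_on_Icc_at_leftD[OF E_cont[of tp] bot(2)] that by auto
  next
    case True
    have "- E x \<le> - E y" if xy: "bt \<le> x" "x \<le> y" "y < tp" for x y
    proof (rule DERIV_nonneg_imp_increasing_open[OF xy(2)])
      show "continuous_on {x..y} (\<lambda>t. - E t)"
        using continuous_on_subset[OF E_cont[of y]] xy by (intro continuous_intros) auto
      fix t assume t: "x < t" "t < y"
      have "0 < c t" using c_pos_right[OF bot(1,3), of t] t xy by simp
      then have "0 \<le> E t * \<rho> t" using E_nonneg dA_nonneg[of t] t xy bot top by (simp add: \<rho>_def)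
      moreover have "((\<lambda>t. - E t) has_real_derivative E t * \<rho> t) (at t)"
        using DERIV_minus[OF E_deriv'[of t]] t xy by simp
      ultimately show "\<exists>z. ((\<lambda>t. - E t) has_real_derivative z) (at t) \<and> 0 \<le> z" by blast
    qed
    moreover have "- E x \<le> 0" for x using E_nonneg by simp
    ultimately obtain l where "((\<lambda>t. - E t) \<longlongrightarrow> l) (at_left tp)"
      using bounded_mono_on_at_left[OF bot(2), of "\<lambda>t. - E t" 0] by metis
    then have "(E \<longlongrightarrow> - l) (at_left tp)"
      using tendsto_minus[of "\<lambda>t. - E t" l] by simp
    then show ?thesis using that True by blast
  qed
  define G where "G t = (if t < tp then E t else L)" for t
  have GE: "eventually (\<lambda>x. E x = G x) (nhds t)" if "t < tp" for t
    using eventually_nhds_in_open[of "{..<tp}" t] that by (auto elim!: eventually_mono simp: G_def)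
  have L0: "0 \<le> L"
    by (rule tendsto_lowerbound[OF L(1)]) (use E_nonneg in auto)
  have deriv: "(G has_real_derivative - (G u * dA u / c u)) (at u)" if u: "bt < u" "u < tp" for u
    using E_deriv'[OF u] GE[OF u(2)] u by (subst (asm) DERIV_cong_ev[OF refl _ refl]) (auto simp: G_def \<rho>_def)
  have "continuous_on {bt..tp} G"
  proof (rule continuous_on_IccI[OF _ _ _ bot(2)])
    obtain u where u: "bt < u" "u < tp" using dense[OF bot(2)] by blast
    have "(E \<longlongrightarrow> E bt) (at_right bt)"
      using continuous_on_Icc_at_rightD[OF E_cont u(1)] u by simp
    moreover have "eventually (\<lambda>x. E x = G x) (at_right bt)"
      using GE[OF bot(2)] eventually_nhds_conv_at[of _ bt] eventually_at_split by blast
    ultimately show "(G \<longlongrightarrow> G bt) (at_right bt)"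
      using bot(2) Lim_transform_eventually[of E] by (simp add: G_def)
    have "eventually (\<lambda>x. E x = G x) (at_left tp)"
      using eventually_at_left_real[OF bot(2)] by eventually_elim (simp add: G_def)
    then show "(G \<longlongrightarrow> G tp) (at_left tp)"
      using L(1) Lim_transform_eventually[of E] by (simp add: G_def)
    show "G \<midarrow>u\<rightarrow> G u" if "bt < u" "u < tp" for u
      using DERIV_isCont[OF deriv[OF that]] by (simp add: isCont_def)
  qed
  moreover have "pb_cdf zP zA \<theta> = (if \<theta> < bt then 0 else if \<theta> < 1 then 1 - G (min \<theta> tp) else 1)" for \<theta>
  proof (cases "bt \<le> \<theta> \<and> \<theta> < 1")
    case True
    \<comment> \<open>As \<open>\<theta> < 1\<close>, the upper end point is never \<open>1\<close>,
      so the integral is an ordinary one even if \<open>c 1 = 0\<close>.\<close>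
    have "exp_neg_int c \<rho> bt (min \<theta> tp) = exp (- R (min \<theta> tp))"
      using True by (auto simp: exp_neg_int_def R_def)
    then have "pb_cdf zP zA \<theta> = 1 - E (min \<theta> tp)"
      using True by (simp add: pb_cdf_def Let_def E_def \<rho>_def[abs_def])
    moreover have "E (min \<theta> tp) = G (min \<theta> tp)"
      using True L(2) top_eq_1 by (cases "c 1 = 0") (auto simp: G_def min_def)
    ultimately show ?thesis using True by simp
  qed (use bot top in \<open>auto simp: pb_cdf_def Let_def\<close>)
  ultimately have "pb_survival G"
    using deriv E_nonneg L0 bot by (auto simp: pb_survival_def G_def E_def R_def)
  then show ?thesis by blast
qed

section \<open>Integration against the saddle distribution\<close>

context
  fixes G
  assumes G: "pb_survival G"
begin

abbreviation "g \<equiv> \<lambda>u. G u * dA u / c u"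

lemma G_cont: "continuous_on {bt..tp} G"
  and G_bot: "G bt = d bt / c bt"
  and G_nonneg: "bt \<le> u \<Longrightarrow> u \<le> tp \<Longrightarrow> 0 \<le> G u"
  and G_deriv: "bt < u \<Longrightarrow> u < tp \<Longrightarrow> (G has_real_derivative - g u) (at u)"
  and pb_cdf_eq: "pb_cdf zP zA \<theta> = (if \<theta> < bt then 0 else if \<theta> < 1 then 1 - G (min \<theta> tp) else 1)"
  using G by (auto simp: pb_survival_def)

text \<open>This is the condition that the atom at \<open>bt\<close>, of mass
  \<open>1 - G bt\<close>, be nonnegative; it is where \<open>d bt \<le> c bt\<close> enters the
  distribution.\<close>

lemma G_bot_le: "G bt \<le> 1"
  using bot_facts(2,3) bot_facts(4)[of bt] by (simp add: G_bot)

lemma g_cont: assumes u: "bt < u" "u < tp" shows "isCont g u"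
proof -
  have u': "0 < u" "u < 1" using u bot_facts(1) top by auto
  have *: "isCont f u" if "continuous_on Theta f" for f :: "real \<Rightarrow> real"
  proof -
    have "continuous_on {0<..<1} f" by (rule continuous_on_subset[OF that]) auto
    then show ?thesis using u' by (auto simp: continuous_on_eq_continuous_at)
  qed
  show ?thesis
    using DERIV_isCont[OF G_deriv[OF u]] *[OF cont_dA] *[OF cont_c] c_pos[OF u']
    by (intro continuous_intros) auto
qed

lemma g_nonneg: "bt < u \<Longrightarrow> u < tp \<Longrightarrow> 0 \<le> g u"
  using G_nonneg[of u] dA_nonneg[of u] c_pos[of u] bot_facts(1) top by simp

lemmas g_integral = integral_neg_derivative[OF _ _ _ G_cont G_deriv g_cont g_nonneg]

lemma G_antimono: "bt \<le> x \<Longrightarrow> x \<le> y \<Longrightarrow> y \<le> tp \<Longrightarrow> G y \<le> G x"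
proof (cases "x = y")
  case False
  assume xy: "bt \<le> x" "x \<le> y" "y \<le> tp"
  then have "(LBINT u:{x<..<y}. g u) \<ge> 0"
    unfolding set_lebesgue_integral_def
    by (intro integral_nonneg_AE always_eventually) (auto simp: indicator_def g_nonneg)
  then show ?thesis using g_integral(2)[of x y] xy False by simp
qed simp

text \<open>The integration formula is all that later arguments use about the law. Indicators of
  half-lines as test functions identify its distribution function.\<close>

lemma pb_cdf_distribution:
  obtains M where "real_distribution M" and "measure M Theta = 1" and "cdf M = pb_cdf zP zA"
    and "\<And>(f :: real \<Rightarrow> real) C. f \<in> borel_measurable borel \<Longrightarrow> (\<And>x. \<bar>f x\<bar> \<le> C) \<Longrightarrow>
      (LINT x|M. f x) = (1 - G bt) * f bt + (LBINT x:{bt<..<tp}. f x * g x) + G tp * f 1"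
proof -
  note bot = bot_facts
  obtain M where M: "real_distribution M"
    and formula: "\<And>(f :: real \<Rightarrow> real) C. f \<in> borel_measurable borel \<Longrightarrow> (\<And>x. \<bar>f x\<bar> \<le> C) \<Longrightarrow>
      (LINT x|M. f x) = (1 - G bt) * f bt + (LBINT x:{bt<..<tp}. f x * g x) + G tp * f 1"
    using real_distribution_two_atoms[OF bot(2) G_cont G_deriv g_cont g_nonneg G_bot_le G_nonneg[of tp]] bot(2)
    by auto
  interpret real_distribution M by fact
  have meas: "measure M S = (1 - G bt) * indicat_real S bt + (LBINT x:{bt<..<tp}. indicat_real S x * g x)
      + G tp * indicat_real S 1" if "S \<in> sets borel" for S
  proof -
    have "\<bar>indicat_real S x\<bar> \<le> 1" for x by (simp add: indicator_def)
    from formula[of "indicat_real S" 1, OF _ this] show ?thesis using that by simp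
  qed
  have total: "(LBINT x:{bt<..<tp}. g x) = G bt - G tp"
    using g_integral(2)[of bt tp] bot by simp
  have "(LBINT x:{bt<..<tp}. indicat_real Theta x * g x) = (LBINT x:{bt<..<tp}. g x)"
    using bot top by (intro set_lebesgue_integral_cong) (auto simp: indicator_def)
  then have Theta1: "measure M Theta = 1"
    using meas[of Theta] total bot top by simp
  have "cdf M \<theta> = pb_cdf zP zA \<theta>" for \<theta>
  proof -
    have mid: "(LBINT x:{bt<..<tp}. indicat_real {..\<theta>} x * g x) = (if \<theta> < bt then 0 else G bt - G (min \<theta> tp))"
    proof -
      consider "\<theta> \<le> bt" | "bt < \<theta>" "\<theta> < tp" | "tp \<le> \<theta>" by linarith
      then show ?thesis
      proof cases
        case 1
        then have "(LBINT x:{bt<..<tp}. indicat_real {..\<theta>} x * g x) = (LBINT x:{bt<..<tp}. 0)"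
          by (intro set_lebesgue_integral_cong) (auto simp: indicator_def)
        then show ?thesis using 1 bot by (auto simp: min_def)
      next
        case 2
        have "(LBINT x:{bt<..<tp}. indicat_real {..\<theta>} x * g x) = (LBINT x:{bt<..<\<theta>}. g x)"
          unfolding set_lebesgue_integral_def
        proof (rule integral_discrete_difference[of "{\<theta>}"])
          fix x assume "x \<notin> {\<theta>}"
          then show "indicat_real {bt<..<tp} x *\<^sub>R (indicat_real {..\<theta>} x * g x) = indicat_real {bt<..<\<theta>} x *\<^sub>R g x"
            using 2 by (auto simp: indicator_def)
        qed auto
        then show ?thesis using g_integral(2)[of bt \<theta>] 2 by simp
      next
        case 3
        then have "(LBINT x:{bt<..<tp}. indicat_real {..\<theta>} x * g x) = (LBINT x:{bt<..<tp}. g x)"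
          by (intro set_lebesgue_integral_cong) (auto simp: indicator_def)
        then show ?thesis using total 3 bot by simp
      qed
    qed
    show ?thesis
      unfolding cdf_def using meas[of "{..\<theta>}"] mid bot top
      by (cases "\<theta> = tp") (auto simp: pb_cdf_eq indicator_def min_def)
  qed
  then show ?thesis using that M Theta1 formula by blast
qed

text \<open>This is \<open>(W G)' = - (W - 2 c \<mu>) g\<close>, integrated; as \<open>\<mu>\<close> may jump, the increments of both sides
  are compared on short intervals instead.\<close>

lemma IC_integral:
  fixes W \<mu>
  assumes W: "\<And>x y. 0 \<le> x \<Longrightarrow> x \<le> y \<Longrightarrow> y \<le> 1 \<Longrightarrow>
      2 * \<mu> x * (zA y - zA x) \<le> W y - W x \<and> W y - W x \<le> 2 * \<mu> y * (zA y - zA x)"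
    and mono: "\<And>x y. 0 \<le> x \<Longrightarrow> x \<le> y \<Longrightarrow> y \<le> 1 \<Longrightarrow> \<mu> x \<le> \<mu> y"
    and bd: "\<And>x. 0 \<le> x \<Longrightarrow> x \<le> 1 \<Longrightarrow> \<bar>\<mu> x\<bar> \<le> B"
    and int: "set_integrable lborel {bt<..<tp} (\<lambda>t. (W t - 2 * c t * \<mu> t) * g t)"
  shows "(LBINT t:{bt<..<tp}. (W t - 2 * c t * \<mu> t) * g t) = W bt * G bt - W tp * G tp"
proof -
  note bot = bot_facts
  define k where "k t = (W t - 2 * c t * \<mu> t) * g t" for t
  have kint: "k integrable_on {bt..tp}"
    using set_borel_integral_eq_integral(1)[OF int] by (simp add: k_def[abs_def] integrable_on_Icc_iff_Ioo)
  have keq: "(LBINT t:{bt<..<tp}. (W t - 2 * c t * \<mu> t) * g t) = integral {bt..tp} k"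
    using set_borel_integral_eq_integral(2)[OF int] by (simp add: k_def[abs_def] integral_open_interval_real)
  have B: "0 \<le> B" using bd[of 0] by simp
  obtain L where L: "\<And>t. t \<in> Theta \<Longrightarrow> dA t \<le> L"
  proof -
    have "bounded (dA ` Theta)"
      by (intro compact_imp_bounded compact_continuous_image cont_dA) auto
    then obtain a where "\<forall>t\<in>Theta. \<bar>dA t\<bar> \<le> a" by (auto simp: bounded_iff)
    then show ?thesis by (intro that[of a]) (meson abs_ge_self order_trans)
  qed
  \<comment> \<open>Constancy of \<open>F\<close> is the claim. \<open>\<alpha>\<close> collects the
    variation of \<open>\<mu>\<close> and of \<open>G\<close>, with \<open>L\<close> converting
    increments of \<open>zA\<close> into lengths; the factor \<open>4\<close> arises because each
    variation enters two error terms with factor \<open>2\<close>.\<close>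
  define F where "F x = W x * G x + integral {bt..x} k" for x
  define \<alpha> where "\<alpha> x = 4 * L * (\<mu> x - B * G x)" for x
  have "F tp = F bt"
  proof (rule eq_of_increment_bound[of bt tp F \<alpha>])
    show "bt \<le> tp" using bot by simp
    fix x y assume xy: "bt \<le> x" "x \<le> y" "y \<le> tp"
    show "\<bar>F y - F x\<bar> \<le> (\<alpha> y - \<alpha> x) * (y - x)"
    proof (cases "x = y")
      case False
      with xy have lt: "x < y" by simp
      define z where "z = zA y - zA x"
      have sub: "{x..y} \<subseteq> Theta" "x \<in> Theta" "y \<in> Theta" using xy bot top by auto
      have z0: "0 \<le> z" using xy bot top by (auto simp: z_def intro: zA_le)
      have dA_int: "(dA has_integral z) {x..y}"
        unfolding z_def
        by (rule fundamental_theorem_of_calculus[OF xy(2)])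
          (use sub in \<open>auto simp: has_real_derivative_iff_has_vector_derivative[symmetric] intro!: DERIV_subset[OF deriv_A]\<close>)
      have zL: "z \<le> L * (y - x)"
        using has_integral_le[OF dA_int has_integral_const_real[of L x y]] L sub xy by (auto simp: mult.commute)
      note gxy = g_integral[OF xy(1) lt xy(3)]
      have g_int: "(g has_integral (G x - G y)) {x<..<y}"
        using set_borel_integral_eq_integral[OF gxy(1)] gxy(2) by (simp add: has_integral_iff)
      have dA_int': "(dA has_integral z) {x<..<y}"
        using dA_int by (simp add: has_integral_Icc_iff_Ioo)
      \<comment> \<open>The product with \<open>c\<close> removes the possible singularity of
        \<open>g\<close>, so its integral \<open>I\<close> lies between \<open>G y * z\<close> and
        \<open>G x * z\<close>.\<close>
      have cg: "c t * g t = G t * dA t" if "t \<in> {x<..<y}" for t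
        using c_pos[of t] that xy bot top by simp
      have G_bds: "G y \<le> G t" "G t \<le> G x" if "t \<in> {x<..<y}" for t
        using G_antimono that xy by auto
      have Gxy: "G y \<le> G x" "0 \<le> G y" "G y \<le> 1" "G x \<le> 1"
        using G_antimono[of x y] G_antimono[of bt x] G_nonneg[of y] G_bot_le xy by auto
      have "continuous_on {x..y} (\<lambda>t. G t * dA t)"
        using xy sub by (intro continuous_intros continuous_on_subset[OF G_cont] continuous_on_subset[OF cont_dA]) auto
      then have "(\<lambda>t. G t * dA t) integrable_on {x<..<y}"
        using integrable_continuous_real by (simp flip: integrable_on_Icc_iff_Ioo)
      then obtain I where "((\<lambda>t. G t * dA t) has_integral I) {x<..<y}" by blast
      then have I: "((\<lambda>t. c t * g t) has_integral I) {x<..<y}"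
        using has_integral_cong[of "{x<..<y}" "\<lambda>t. G t * dA t" "\<lambda>t. c t * g t" I] cg by auto
      have dA0: "0 \<le> dA t" if "t \<in> {x<..<y}" for t using dA_nonneg[of t] that sub by auto
      have I1: "G y * z \<le> I"
        by (rule has_integral_le[OF has_integral_mult_right[OF dA_int'] I])
          (use cg dA0 G_bds in \<open>auto intro!: mult_right_mono\<close>)
      have I2: "I \<le> G x * z"
        by (rule has_integral_le[OF I has_integral_mult_right[OF dA_int']])
          (use cg dA0 G_bds in \<open>auto intro!: mult_right_mono\<close>)
      define D where "D = integral {x..y} k"
      have kxy: "k integrable_on {x..y}"
        by (rule integrable_on_subinterval[OF kint]) (use xy in auto)
      have FD: "F y - F x = W y * G y - W x * G x + D"
        unfolding F_def D_def
        using Henstock_Kurzweil_Integration.integral_combine[OF xy(1,2) integrable_on_subinterval[OF kint]] xy by auto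
      have D: "(k has_integral D) {x<..<y}"
        using kxy by (simp add: D_def has_integral_integrable_integral integrable_on_Icc_iff_Ioo integral_open_interval_real)
      \<comment> \<open>The integrand minus its version with \<open>W\<close> and
        \<open>\<mu>\<close> frozen at \<open>x\<close>. Over \<open>[x, y]\<close> the rent moves
        by at most \<open>2 * B * z\<close> and the mean by at most \<open>\<delta>\<close>.\<close>
      have err: "((\<lambda>t. k t - W x * g t + 2 * \<mu> x * (c t * g t)) has_integral (D - W x * (G x - G y) + 2 * \<mu> x * I)) {x<..<y}"
        by (intro has_integral_add has_integral_diff has_integral_mult_right D g_int I)
      define \<delta> where "\<delta> = \<mu> y - \<mu> x"
      have bnd: "((\<lambda>t. 2 * B * z * g t + 2 * \<delta> * (c t * g t)) has_integral (2 * B * z * (G x - G y) + 2 * \<delta> * I)) {x<..<y}"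
        by (intro has_integral_add has_integral_mult_right g_int I)
      have "\<bar>D - W x * (G x - G y) + 2 * \<mu> x * I\<bar> \<le> 2 * B * z * (G x - G y) + 2 * \<delta> * I"
      proof -
        have "norm (integral {x<..<y} (\<lambda>t. k t - W x * g t + 2 * \<mu> x * (c t * g t)))
          \<le> integral {x<..<y} (\<lambda>t. 2 * B * z * g t + 2 * \<delta> * (c t * g t))"
        proof (rule integral_norm_bound_integral)
          fix t assume t: "t \<in> {x<..<y}"
          then have t': "0 \<le> x" "x \<le> t" "t \<le> y" "y \<le> 1" using sub by auto
          have g0: "0 \<le> g t" using g_nonneg[of t] t xy by auto
          have c0: "0 \<le> c t" using c_pos[of t] t sub by auto
          have "zA t - zA x \<le> z" "0 \<le> zA t - zA x" using t' by (auto simp: z_def intro: zA_le)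
          then have "\<mu> t * (zA t - zA x) \<le> B * z" "- (B * z) \<le> \<mu> x * (zA t - zA x)"
            using bd[of t] bd[of x] t' B z0 mult_mono[of "\<mu> t" B "zA t - zA x" z]
              mult_mono[of "- \<mu> x" B "zA t - zA x" z] by (auto simp: abs_le_iff)
          then have "\<bar>W t - W x\<bar> \<le> 2 * B * z" using W[of x t] t' by auto
          then have e1: "\<bar>(W t - W x) * g t\<bar> \<le> 2 * B * z * g t"
            unfolding abs_mult abs_of_nonneg[OF g0] using g0 by (rule mult_right_mono)
          have "0 \<le> \<mu> t - \<mu> x" "\<mu> t - \<mu> x \<le> \<delta>" using mono[of x t] mono[of t y] t' by (auto simp: \<delta>_def)
          then have e2: "\<bar>(\<mu> t - \<mu> x) * (c t * g t)\<bar> \<le> \<delta> * (c t * g t)"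
            unfolding abs_mult[of "\<mu> t - \<mu> x"] abs_of_nonneg[OF mult_nonneg_nonneg[OF c0 g0]]
            by (intro mult_right_mono mult_nonneg_nonneg[OF c0 g0]) auto
          have "(W t - 2 * c t * \<mu> t) * \<gamma> - W x * \<gamma> + 2 * \<mu> x * (c t * \<gamma>)
              = (W t - W x) * \<gamma> - 2 * ((\<mu> t - \<mu> x) * (c t * \<gamma>))" for \<gamma>
            by (simp add: algebra_simps)
          then have eq: "k t - W x * g t + 2 * \<mu> x * (c t * g t) = (W t - W x) * g t - 2 * ((\<mu> t - \<mu> x) * (c t * g t))"
            unfolding k_def .
          have lin: "\<bar>P - 2 * Q\<bar> \<le> X + 2 * Y" if "\<bar>P\<bar> \<le> X" "\<bar>Q\<bar> \<le> Y" for P Q X Y :: real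
            using that by linarith
          show "norm (k t - W x * g t + 2 * \<mu> x * (c t * g t)) \<le> 2 * B * z * g t + 2 * \<delta> * (c t * g t)"
            unfolding eq real_norm_def using lin[OF e1 e2] by (simp only: mult.assoc)
        qed (use err bnd in blast)+
        then show ?thesis using err bnd by (simp add: integral_unique)
      qed
      moreover have "\<bar>G y * (W y - W x - 2 * \<mu> x * z)\<bar> \<le> 2 * \<delta> * z"
      proof -
        have w: "0 \<le> W y - W x - 2 * \<mu> x * z" "W y - W x - 2 * \<mu> x * z \<le> 2 * \<delta> * z"
          using W[of x y] sub xy by (auto simp: z_def \<delta>_def algebra_simps)
        then have "G y * (W y - W x - 2 * \<mu> x * z) \<le> 1 * (2 * \<delta> * z)"
          using Gxy by (intro mult_mono) auto
        then show ?thesis using w Gxy by simp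
      qed
      moreover have "\<bar>2 * \<mu> x * (G y * z - I)\<bar> \<le> 2 * B * ((G x - G y) * z)"
      proof -
        have "\<bar>\<mu> x\<bar> * \<bar>G y * z - I\<bar> \<le> B * ((G x - G y) * z)"
          using I1 I2 bd[of x] sub B by (intro mult_mono) (auto simp: algebra_simps)
        then show ?thesis by (simp add: abs_mult)
      qed
      \<comment> \<open>Three errors: freezing \<open>W\<close> and \<open>\<mu>\<close>, the gap in
        the envelope inequality weighted by \<open>G y\<close>, and replacing \<open>I\<close> by
        \<open>G y * z\<close>.\<close>
      moreover have "F y - F x = (D - W x * (G x - G y) + 2 * \<mu> x * I) + G y * (W y - W x - 2 * \<mu> x * z)
          + 2 * \<mu> x * (G y * z - I)"
        by (simp add: FD algebra_simps)
      moreover have "2 * \<delta> * I \<le> 2 * \<delta> * z"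
      proof -
        have "G x * z \<le> 1 * z" using Gxy z0 by (intro mult_right_mono) auto
        moreover have "0 \<le> \<delta>" using mono[of x y] sub xy by (auto simp: \<delta>_def)
        ultimately show ?thesis using I2 by (intro mult_left_mono) auto
      qed
      ultimately have "\<bar>F y - F x\<bar> \<le> 2 * B * z * (G x - G y) + 2 * \<delta> * z + 2 * \<delta> * z + 2 * B * ((G x - G y) * z)"
        by linarith
      also have "\<dots> = 4 * (\<delta> + B * (G x - G y)) * z"
        by (simp add: algebra_simps)
      also have "\<dots> \<le> 4 * (\<delta> + B * (G x - G y)) * (L * (y - x))"
        using zL B Gxy mono[of x y] sub xy by (intro mult_left_mono) (auto simp: \<delta>_def)
      also have "\<dots> = (\<alpha> y - \<alpha> x) * (y - x)"
        by (simp add: \<alpha>_def \<delta>_def algebra_simps)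
      finally show ?thesis .
    qed simp
  qed
  then show ?thesis using keq by (simp add: F_def)
qed

end

end

section \<open>The saddle point for positive bias\<close>

lemma borel_measurable_indicator_restrict:
  fixes f :: "real \<Rightarrow> real"
  assumes "f \<in> borel_measurable (restrict_space borel S)" "S \<in> sets borel"
  shows "(\<lambda>x. indicator S x * f x) \<in> borel_measurable borel"
  using assms by (simp add: borel_measurable_restrict_space_iff)

lemma continuous_on_Theta_bounded:
  assumes "continuous_on Theta y"
  obtains Z :: real where "\<And>\<theta>. \<theta> \<in> Theta \<Longrightarrow> \<bar>y \<theta>\<bar> \<le> Z"
proof -
  have "bounded (y ` Theta)"
    by (intro compact_imp_bounded compact_continuous_image assms) auto
  then obtain a where "\<forall>\<theta>\<in>Theta. \<bar>y \<theta>\<bar> \<le> a" by (auto simp: bounded_iff)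
  then show ?thesis by (intro that[of a]) blast
qed

text \<open>Type distributions live on the whole line while mechanisms are constrained only on
  \<open>Theta\<close>; the indicator extends the payoff by zero to a bounded Borel
  function.\<close>

lemma payoff_borel_bounded:
  assumes m: "mechanism A m" and A: "A \<subseteq> {-B..B}" and y: "continuous_on Theta y"
  shows "(\<lambda>\<theta>. indicator Theta \<theta> * payoff y m \<theta> \<theta>) \<in> borel_measurable borel"
    and "\<exists>C. \<forall>\<theta>. \<bar>indicator Theta \<theta> * payoff y m \<theta> \<theta>\<bar> \<le> C"
proof -
  have [measurable]: "y \<in> borel_measurable (restrict_space borel Theta)"
    by (rule borel_measurable_continuous_on_restrict[OF y])
  note [measurable] = mechanism_measurable[OF m]
  have "(\<lambda>\<theta>. 2 * y \<theta> * mech_mean m \<theta> - mech_second m \<theta> - (y \<theta>)\<^sup>2)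
      \<in> borel_measurable (restrict_space borel Theta)"
    by measurable
  from borel_measurable_indicator_restrict[OF this]
  have "(\<lambda>\<theta>. indicator Theta \<theta> * (2 * y \<theta> * mech_mean m \<theta> - mech_second m \<theta> - (y \<theta>)\<^sup>2)) \<in> borel_measurable borel"
    by simp
  also have "(\<lambda>\<theta>. indicator Theta \<theta> * (2 * y \<theta> * mech_mean m \<theta> - mech_second m \<theta> - (y \<theta>)\<^sup>2))
      = (\<lambda>\<theta>. indicator Theta \<theta> * payoff y m \<theta> \<theta>)"
    by (auto simp: fun_eq_iff indicator_def payoff_eq[OF m _ A])
  finally show "(\<lambda>\<theta>. indicator Theta \<theta> * payoff y m \<theta> \<theta>) \<in> borel_measurable borel" .
  obtain Z where Z: "\<And>\<theta>. \<theta> \<in> Theta \<Longrightarrow> \<bar>y \<theta>\<bar> \<le> Z"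
    using continuous_on_Theta_bounded[OF y] by blast
  have bnd: "\<bar>payoff y m \<theta> \<theta>\<bar> \<le> 2 * (Z * B) + B\<^sup>2 + Z\<^sup>2" if t: "\<theta> \<in> Theta" for \<theta>
  proof -
    have "\<bar>y \<theta>\<bar> * \<bar>mech_mean m \<theta>\<bar> \<le> Z * B"
      using Z[OF t] mech_mean_bound[OF m t A] by (intro mult_mono) auto
    moreover have "(y \<theta>)\<^sup>2 \<le> Z\<^sup>2"
      using power_mono[OF Z[OF t], of 2] by simp
    ultimately show ?thesis
      using mech_second_bound[OF m t A] zero_le_power2[of "y \<theta>"]
      unfolding payoff_eq[OF m t A] abs_mult[symmetric] mult.assoc by linarith
  qed
  have "\<bar>indicator Theta \<theta> * payoff y m \<theta> \<theta>\<bar> \<le> \<bar>2 * (Z * B) + B\<^sup>2 + Z\<^sup>2\<bar>" for \<theta>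
    using order_trans[OF bnd abs_ge_self] by (cases "\<theta> \<in> Theta") auto
  then show "\<exists>C. \<forall>\<theta>. \<bar>indicator Theta \<theta> * payoff y m \<theta> \<theta>\<bar> \<le> C" by blast
qed

lemma value_P_cdf:
  assumes "real_distribution M"
  shows "value_P y m (cdf M) = (LINT \<theta>|M. indicator Theta \<theta> * payoff y m \<theta> \<theta>)"
  by (simp add: value_P_def interval_measure_cdf[OF assms] set_lebesgue_integral_def)

context positive_bias
begin

text \<open>The \<open>W\<close> of the overview: the agent's truthful payoff without the term
  \<open>- (zA \<theta>)\<^sup>2\<close>, which does not depend on the mechanism.\<close>

definition rent :: "(real \<Rightarrow> real measure) \<Rightarrow> real \<Rightarrow> real" where
  "rent m \<theta> = 2 * zA \<theta> * mech_mean m \<theta> - mech_second m \<theta>"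

text \<open>By reporting \<open>x\<close>, type \<open>y\<close> secures the rent of
  \<open>x\<close> plus \<open>2 \<mu>(x) (zA y - zA x)\<close>, and symmetrically. Both bounds
  together order the means, because \<open>zA\<close> is strictly increasing.\<close>

lemma IC_rent:
  assumes m: "m \<in> IC_mechanisms A zA" and A: "A \<subseteq> {-B..B}" and xy: "0 \<le> x" "x \<le> y" "y \<le> 1"
  shows "2 * mech_mean m x * (zA y - zA x) \<le> rent m y - rent m x"
    and "rent m y - rent m x \<le> 2 * mech_mean m y * (zA y - zA x)"
    and "mech_mean m x \<le> mech_mean m y"
proof -
  have IC: "2 * zA \<theta> * (mech_mean m \<theta>' - mech_mean m \<theta>) \<le> mech_second m \<theta>' - mech_second m \<theta>"
    if "\<theta> \<in> Theta" "\<theta>' \<in> Theta" for \<theta> \<theta>'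
    using m that by (simp add: IC_mechanisms_iff[OF A])
  show 1: "2 * mech_mean m x * (zA y - zA x) \<le> rent m y - rent m x"
    using IC[of y x] xy by (simp add: rent_def algebra_simps)
  show 2: "rent m y - rent m x \<le> 2 * mech_mean m y * (zA y - zA x)"
    using IC[of x y] xy by (simp add: rent_def algebra_simps)
  show "mech_mean m x \<le> mech_mean m y"
  proof (cases "x = y")
    case False
    then have "zA x < zA y" using strict_mono_onD[OF mono_A, of x y] xy by auto
    moreover have "mech_mean m x * (zA y - zA x) \<le> mech_mean m y * (zA y - zA x)"
      using 1 2 by linarith
    ultimately show ?thesis by simp
  qed simp
qed

lemma payoff_rent:
  assumes "mechanism A m" "A \<subseteq> {-B..B}" "\<theta> \<in> Theta"
  shows "payoff zP m \<theta> \<theta> = rent m \<theta> - 2 * c \<theta> * mech_mean m \<theta> - (zP \<theta>)\<^sup>2"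
  unfolding payoff_eq[OF assms(1,3,2)] by (simp add: rent_def pb_c_def algebra_simps)

text \<open>One constant \<open>K\<close> serves all incentive-compatible mechanisms, since it
  collects only terms in \<open>zP\<close>. Comparing mechanisms thus reduces to their moments at
  \<open>bt\<close>, \<open>tp\<close> and \<open>1\<close>.\<close>

lemma value_P_pb_cdf:
  assumes G: "pb_survival G" and A: "A \<subseteq> {-B..B}"
  obtains K where "\<And>m. m \<in> IC_mechanisms A zA \<Longrightarrow> value_P zP m (pb_cdf zP zA) =
     rent m bt - 2 * (c bt - d bt) * mech_mean m bt + G tp * (rent m 1 - rent m tp - 2 * c 1 * mech_mean m 1) + K"
proof -
  note bot = bot_facts
  let ?g = "\<lambda>u. G u * dA u / c u"
  obtain M where M: "real_distribution M" "measure M Theta = 1" "cdf M = pb_cdf zP zA"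
    and formula: "\<And>(f :: real \<Rightarrow> real) C. f \<in> borel_measurable borel \<Longrightarrow> (\<And>x. \<bar>f x\<bar> \<le> C) \<Longrightarrow>
      (LINT x|M. f x) = (1 - G bt) * f bt + (LBINT x:{bt<..<tp}. f x * ?g x) + G tp * f 1"
    using pb_cdf_distribution[OF G] by blast
  define I where "I = (LBINT x:{bt<..<tp}. (zP x)\<^sup>2 * ?g x)"
  have g_int: "set_integrable lborel {bt<..<tp} ?g"
    using g_integral(1)[OF G, of bt tp] bot by simp
  have zI: "set_integrable lborel {bt<..<tp} (\<lambda>x. (zP x)\<^sup>2 * ?g x)"
  proof -
    obtain Z where Z: "\<And>\<theta>. \<theta> \<in> Theta \<Longrightarrow> \<bar>zP \<theta>\<bar> \<le> Z"
      using continuous_on_Theta_bounded[OF cont_P] by blast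
    have [measurable]: "zP \<in> borel_measurable (restrict_space borel Theta)"
      by (rule borel_measurable_continuous_on_restrict[OF cont_P])
    have "(\<lambda>x. (zP x)\<^sup>2) \<in> borel_measurable (restrict_space borel Theta)" by measurable
    from borel_measurable_indicator_restrict[OF this]
    have "(\<lambda>x. indicator Theta x * (zP x)\<^sup>2) \<in> borel_measurable borel" by simp
    moreover have "\<bar>indicator Theta x * (zP x)\<^sup>2\<bar> \<le> Z\<^sup>2" for x
      using power_mono[OF Z[of x], of 2] by (cases "x \<in> Theta") auto
    ultimately have "set_integrable lborel {bt<..<tp} (\<lambda>x. (indicator Theta x * (zP x)\<^sup>2) * ?g x)"
      by (rule set_integrable_bounded_mult[OF g_int])
    then show ?thesis
      by (rule set_integrable_cong[THEN iffD1, rotated -1]) (use bot top in \<open>auto simp: indicator_def\<close>)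
  qed
  show ?thesis
  proof (rule that[of "- (1 - G bt) * (zP bt)\<^sup>2 - I - G tp * (zP 1)\<^sup>2"])
    fix m assume m: "m \<in> IC_mechanisms A zA"
    then have mech: "mechanism A m" by (simp add: IC_mechanisms_def)
    let ?f = "\<lambda>\<theta>. indicator Theta \<theta> * payoff zP m \<theta> \<theta>"
    obtain C where C: "\<And>\<theta>. \<bar>?f \<theta>\<bar> \<le> C"
      using payoff_borel_bounded(2)[OF mech A cont_P] by blast
    note f = payoff_borel_bounded(1)[OF mech A cont_P]
    define k where "k t = (rent m t - 2 * c t * mech_mean m t) * ?g t" for t
    have fg: "set_integrable lborel {bt<..<tp} (\<lambda>x. ?f x * ?g x)"
      by (rule set_integrable_bounded_mult[OF g_int f C])
    have k_eq: "k x = ?f x * ?g x + (zP x)\<^sup>2 * ?g x" if "x \<in> {bt<..<tp}" for x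
    proof -
      have x: "x \<in> Theta" using that bot top by auto
      show ?thesis
        unfolding k_def payoff_rent[OF mech A x] distrib_right[symmetric] using x by simp
    qed
    have k_int: "set_integrable lborel {bt<..<tp} k"
      using set_integral_add(1)[OF fg zI]
      by (rule set_integrable_cong[THEN iffD1, rotated -1]) (use k_eq in auto)
    have "(LBINT x:{bt<..<tp}. k x) = (LBINT x:{bt<..<tp}. ?f x * ?g x + (zP x)\<^sup>2 * ?g x)"
      by (rule set_lebesgue_integral_cong) (use k_eq in auto)
    also have "\<dots> = (LBINT x:{bt<..<tp}. ?f x * ?g x) + I"
      unfolding I_def by (rule set_integral_add(2)[OF fg zI])
    finally have "(LBINT x:{bt<..<tp}. ?f x * ?g x) = (LBINT x:{bt<..<tp}. k x) - I" by simp
    also have "(LBINT x:{bt<..<tp}. k x) = rent m bt * G bt - rent m tp * G tp"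
      unfolding k_def
    proof (rule IC_integral[OF G])
      show "set_integrable lborel {bt<..<tp} (\<lambda>t. (rent m t - 2 * c t * mech_mean m t) * ?g t)"
        using k_int by (simp add: k_def[abs_def])
      show "\<bar>mech_mean m x\<bar> \<le> B" if "0 \<le> x" "x \<le> 1" for x
        using mech_mean_bound[OF mech _ A, of x] that by simp
    qed (use IC_rent[OF m A] in auto)
    finally have "value_P zP m (pb_cdf zP zA) = (1 - G bt) * payoff zP m bt bt
        + (rent m bt * G bt - rent m tp * G tp - I) + G tp * payoff zP m 1 1"
      using formula[OF f C] bot top by (simp add: value_P_cdf[OF M(1)] flip: M(3))
    moreover have "payoff zP m bt bt = rent m bt - 2 * c bt * mech_mean m bt - (zP bt)\<^sup>2"
      "payoff zP m 1 1 = rent m 1 - 2 * c 1 * mech_mean m 1 - (zP 1)\<^sup>2"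
      using bot top by (auto intro!: payoff_rent[OF mech A])
    \<comment> \<open>The size of the atom enters here:
      \<open>(1 - G bt) (W - 2 c \<mu>) + G bt W\<close> at \<open>bt\<close> becomes
      \<open>W - 2 (c - d) \<mu>\<close>.\<close>
    moreover have "d bt = G bt * c bt"
      using bot(3) by (simp add: G_bot[OF G])
    ultimately show "value_P zP m (pb_cdf zP zA) = rent m bt - 2 * (c bt - d bt) * mech_mean m bt
        + G tp * (rent m 1 - rent m tp - 2 * c 1 * mech_mean m 1)
        + (- (1 - G bt) * (zP bt)\<^sup>2 - I - G tp * (zP 1)\<^sup>2)"
      by (simp add: algebra_simps)
  qed
qed

lemma pb_optimal:
  assumes star: "pb_mechanism A zP zA ms" and A: "A \<subseteq> {-B..B}" and m: "m \<in> IC_mechanisms A zA"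
  shows "value_P zP m (pb_cdf zP zA) \<le> value_P zP ms (pb_cdf zP zA)"
proof -
  note bot = bot_facts
  obtain G where G: "pb_survival G" using pb_survival_exists by blast
  obtain K where K: "\<And>m. m \<in> IC_mechanisms A zA \<Longrightarrow> value_P zP m (pb_cdf zP zA) =
     rent m bt - 2 * (c bt - d bt) * mech_mean m bt + G tp * (rent m 1 - rent m tp - 2 * c 1 * mech_mean m 1) + K"
    using value_P_pb_cdf[OF G A] by blast
  have mech: "mechanism A m" using m by (simp add: IC_mechanisms_def)
  have Th: "bt \<in> Theta" "tp \<in> Theta" "1 \<in> Theta" using bot top by auto
  have G0: "0 \<le> G tp" using G_nonneg[OF G, of tp] bot by simp
  have "rent m bt - 2 * (c bt - d bt) * mech_mean m bt \<le> (zP bt + d bt)\<^sup>2"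
  proof -
    \<comment> \<open>The left side is \<open>2 (zP + d) \<mu>\<close> minus the second moment at
      \<open>bt\<close>; completing the square leaves the variance as the slack.\<close>
    have "rent m bt - 2 * (c bt - d bt) * mech_mean m bt
        \<le> (zP bt + d bt)\<^sup>2 - (mech_mean m bt - (zP bt + d bt))\<^sup>2"
      using mech_var_nonneg[OF mech Th(1) A] by (simp add: rent_def pb_c_def power2_eq_square algebra_simps)
    then show ?thesis by (smt (verit) zero_le_power2)
  qed
  moreover have "rent ms bt - 2 * (c bt - d bt) * mech_mean ms bt = (zP bt + d bt)\<^sup>2"
  proof -
    have "pb_mean zP zA bt = zP bt + d bt" "pb_var zP zA bt = 0"
      using bot by (auto simp: pb_mean_def pb_var_def)
    then show ?thesis
      unfolding rent_def pb_mechanism_moments[OF star A Th(1)]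
      by (simp add: pb_c_def power2_eq_square algebra_simps)
  qed
  \<comment> \<open>Because \<open>zA tp = zP 1\<close>, the increment \<open>zA 1 - zA tp\<close>
    equals \<open>c 1\<close>, and this is the envelope bound between \<open>tp\<close> and
    \<open>1\<close>.\<close>
  moreover have "rent m 1 - rent m tp - 2 * c 1 * mech_mean m 1 \<le> 0"
    using IC_rent(2)[OF m A, of tp 1] top by (simp add: zA_top pb_c_def algebra_simps)
  moreover have "rent ms 1 - rent ms tp - 2 * c 1 * mech_mean ms 1 = 0"
  proof (cases "tp = 1")
    case True
    then show ?thesis using zA_top by (simp add: pb_c_def)
  next
    case False
    have zP1: "zP 1 = zP tp + c tp" by (simp add: c_top)
    have tp1: "tp < 1" using False top by simp
    have mean: "pb_mean zP zA 1 = pb_mean zP zA tp"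
      using mu_top tp1 bot by (simp add: pb_mean_def)
    have var: "pb_var zP zA 1 = pb_var zP zA tp"
      using tp1 bot by (simp add: pb_var_def pb_d_top power2_eq_square)
    show ?thesis
      unfolding rent_def pb_mechanism_moments[OF star A Th(2)] pb_mechanism_moments[OF star A Th(3)] mean var
      by (simp add: pb_c_def zA_top algebra_simps)
  qed
  ultimately show ?thesis
    using K[OF m] K[OF pb_mechanism_IC[OF star A]]
      mult_nonneg_nonpos[OF G0, of "rent m 1 - rent m tp - 2 * c 1 * mech_mean m 1"] by simp
qed

lemma pb_worst_case:
  assumes star: "pb_mechanism A zP zA ms" and A: "A \<subseteq> {-B..B}" and F: "F \<in> CDFs_Theta"
  shows "- (d bt)\<^sup>2 \<le> value_P zP ms F"
proof -
  from F obtain M where M: "real_distribution M" "measure M Theta = 1" "F = cdf M"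
    by (auto simp: CDFs_Theta_def)
  interpret real_distribution M by fact
  have mech: "mechanism A ms" using star by (simp add: pb_mechanism_def)
  let ?f = "\<lambda>\<theta>. indicator Theta \<theta> * payoff zP ms \<theta> \<theta>"
  obtain C where C: "\<And>\<theta>. \<bar>?f \<theta>\<bar> \<le> C"
    using payoff_borel_bounded(2)[OF mech A cont_P] by blast
  have int: "integrable M ?f"
    using C payoff_borel_bounded(1)[OF mech A cont_P] by (intro integrable_const_bound[of _ C]) auto
  have "AE \<theta> in M. \<theta> \<in> Theta" using M(2) by (subst AE_in_set_eq_1) auto
  then have "AE \<theta> in M. - (d bt)\<^sup>2 \<le> ?f \<theta>"
    by eventually_elim (use pb_mechanism_payoff(1)[OF star A] in auto)
  from integral_ge_const[OF int this] show ?thesis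
    by (simp add: M(3) value_P_cdf[OF M(1)])
qed

lemma pb_value:
  assumes star: "pb_mechanism A zP zA ms" and A: "A \<subseteq> {-B..B}"
  shows "value_P zP ms (pb_cdf zP zA) = - (d bt)\<^sup>2" and "pb_cdf zP zA \<in> CDFs_Theta"
proof -
  note bot = bot_facts
  obtain G where G: "pb_survival G" using pb_survival_exists by blast
  let ?g = "\<lambda>u. G u * dA u / c u"
  obtain M where M: "real_distribution M" "measure M Theta = 1" "cdf M = pb_cdf zP zA"
    and formula: "\<And>(f :: real \<Rightarrow> real) C. f \<in> borel_measurable borel \<Longrightarrow> (\<And>x. \<bar>f x\<bar> \<le> C) \<Longrightarrow>
      (LINT x|M. f x) = (1 - G bt) * f bt + (LBINT x:{bt<..<tp}. f x * ?g x) + G tp * f 1"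
    using pb_cdf_distribution[OF G] by blast
  interpret real_distribution M by fact
  show "pb_cdf zP zA \<in> CDFs_Theta" unfolding CDFs_Theta_def mem_Collect_eq using M by (intro exI[of _ M]) auto
  have mech: "mechanism A ms" using star by (simp add: pb_mechanism_def)
  let ?f = "\<lambda>\<theta>. indicator Theta \<theta> * payoff zP ms \<theta> \<theta>"
  obtain C where C: "\<And>\<theta>. \<bar>?f \<theta>\<bar> \<le> C"
    using payoff_borel_bounded(2)[OF mech A cont_P] by blast
  have pay: "?f \<theta> = - (d bt)\<^sup>2" if "bt \<le> \<theta> \<and> \<theta> \<le> tp \<or> \<theta> = 1" for \<theta>
    using pb_mechanism_payoff(2)[OF star A _ that] that bot top by auto
  have "(LINT \<theta>|M. ?f \<theta>) = (1 - G bt) * ?f bt + (LBINT x:{bt<..<tp}. ?f x * ?g x) + G tp * ?f 1"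
    by (rule formula[OF payoff_borel_bounded(1)[OF mech A cont_P] C])
  also have "(LBINT x:{bt<..<tp}. ?f x * ?g x) = (LBINT x:{bt<..<tp}. - (d bt)\<^sup>2 * ?g x)"
    by (rule set_lebesgue_integral_cong) (use pay in auto)
  \<comment> \<open>Applying the integration formula to a constant function makes the masses sum to
    one without evaluating the density.\<close>
  also have "(1 - G bt) * ?f bt + (LBINT x:{bt<..<tp}. - (d bt)\<^sup>2 * ?g x) + G tp * ?f 1 = (LINT \<theta>|M. - (d bt)\<^sup>2)"
    using formula[of "\<lambda>_. - (d bt)\<^sup>2" "(d bt)\<^sup>2"] pay[of bt] pay[of 1] bot by simp
  finally show "value_P zP ms (pb_cdf zP zA) = - (d bt)\<^sup>2"
    using value_P_cdf[OF M(1)] prob_space by (simp flip: M(3))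
qed

theorem pb_saddle_point:
  assumes star: "pb_mechanism A zP zA ms" and A: "A \<subseteq> {-B..B}"
  shows "saddle_point A zP zA ms (pb_cdf zP zA)"
  unfolding saddle_point_def
  using pb_mechanism_IC[OF star A] pb_value[OF star A] pb_worst_case[OF star A] pb_optimal[OF star A]
  by simp

end

section \<open>Reflection\<close>

lemma reflect_actions_involution [simp]: "reflect_actions \<kappa> (reflect_actions \<kappa> A) = A"
  by (simp add: reflect_actions_def image_image)

lemma reflect_pref_involution [simp]: "reflect_pref \<kappa> (reflect_pref \<kappa> y) = y"
  by (simp add: reflect_pref_def fun_eq_iff)

lemma bounded_real_subset_Icc:
  assumes "bounded (A :: real set)"
  obtains B where "A \<subseteq> {-B..B}"
proof -
  obtain B where "\<forall>x\<in>A. \<bar>x\<bar> \<le> B" using assms by (auto simp: bounded_iff)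
  then have "A \<subseteq> {-B..B}" by (force simp: abs_le_iff)
  then show ?thesis by (rule that)
qed

lemma bounded_reflect_actions:
  assumes "bounded A"
  shows "bounded (reflect_actions \<kappa> A)"
proof -
  obtain B where "A \<subseteq> {-B..B}" using bounded_real_subset_Icc[OF assms] .
  then have "reflect_actions \<kappa> A \<subseteq> {\<kappa> - B..\<kappa> + B}" by (force simp: reflect_actions_def)
  then show ?thesis by (rule bounded_subset[OF bounded_closed_interval])
qed

lemma reflect_actions_measurable:
  "(\<lambda>a. \<kappa> - a) \<in> restrict_space borel A \<rightarrow>\<^sub>M restrict_space borel (reflect_actions \<kappa> A)"
  by (rule measurable_restrict_space3) (auto simp: reflect_actions_def)

lemma mechanism_reflect:
  assumes "mechanism A m"
  shows "mechanism (reflect_actions \<kappa> A) (reflect_mech \<kappa> A m)"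
proof -
  have "(\<lambda>\<theta>. 1 - \<theta>) \<in> restrict_space borel Theta \<rightarrow>\<^sub>M restrict_space borel Theta"
    by (rule measurable_restrict_space3) auto
  from measurable_compose[OF measurable_compose[OF this assms[unfolded mechanism_def]]
      measurable_distr_prob_space[OF reflect_actions_measurable]]
  show ?thesis by (simp add: mechanism_def reflect_mech_def[abs_def])
qed

lemma payoff_reflect:
  assumes "mechanism A m" "\<theta>' \<in> Theta"
  shows "payoff (reflect_pref \<kappa> y) (reflect_mech \<kappa> A m) \<theta> \<theta>' = payoff y m (1 - \<theta>) (1 - \<theta>')"
proof -
  let ?N = "restrict_space borel (reflect_actions \<kappa> A)"
  have sets: "sets (m (1 - \<theta>')) = sets (restrict_space borel A)"
    using mechanismD(2)[OF assms(1), of "1 - \<theta>'"] assms(2) by auto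
  have "(\<lambda>a. \<kappa> - a) \<in> m (1 - \<theta>') \<rightarrow>\<^sub>M ?N"
    using reflect_actions_measurable sets by (simp cong: measurable_cong_sets)
  moreover have "(\<lambda>a. (a - reflect_pref \<kappa> y \<theta>)\<^sup>2) \<in> borel_measurable ?N"
    by (intro measurable_restrict_space1) measurable
  ultimately have "(LINT a|reflect_mech \<kappa> A m \<theta>'. (a - reflect_pref \<kappa> y \<theta>)\<^sup>2)
      = (LINT a|m (1 - \<theta>'). (\<kappa> - a - reflect_pref \<kappa> y \<theta>)\<^sup>2)"
    unfolding reflect_mech_def by (rule integral_distr)
  also have "\<dots> = (LINT a|m (1 - \<theta>'). (a - y (1 - \<theta>))\<^sup>2)"
    by (simp add: reflect_pref_def power2_commute)
  finally show ?thesis by (simp add: payoff_def)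
qed

lemma IC_mechanisms_reflect:
  assumes "m \<in> IC_mechanisms A y"
  shows "reflect_mech \<kappa> A m \<in> IC_mechanisms (reflect_actions \<kappa> A) (reflect_pref \<kappa> y)"
proof -
  have m: "mechanism A m" using assms by (simp add: IC_mechanisms_def)
  show ?thesis
    using assms by (auto simp: IC_mechanisms_def mechanism_reflect payoff_reflect[OF m])
qed

text \<open>The left limit yields the mass strictly below \<open>1 - \<theta>\<close>; its
  complement keeps a possible atom at \<open>1 - \<theta>\<close>, as the preimage of
  \<open>{..\<theta>}\<close> requires.\<close>

lemma reflect_cdf_cdf:
  assumes "real_distribution M"
  shows "reflect_cdf (cdf M) = cdf (distr M borel (\<lambda>x. 1 - x))"
proof
  fix \<theta>
  interpret real_distribution M by fact
  have "Lim (at_left (1 - \<theta>)) (cdf M) = measure M {..<1 - \<theta>}"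
    by (rule tendsto_Lim[OF _ cdf_at_left]) simp
  moreover have "measure (distr M borel (\<lambda>x. 1 - x)) {..\<theta>} = measure M (- {..<1 - \<theta>})"
    by (subst measure_distr) (auto intro!: arg_cong[where f="measure M"])
  moreover have "measure M (- {..<1 - \<theta>}) = 1 - measure M {..<1 - \<theta>}"
    using prob_compl[of "{..<1 - \<theta>}"] by (simp add: Compl_eq_Diff_UNIV)
  ultimately show "reflect_cdf (cdf M) \<theta> = cdf (distr M borel (\<lambda>x. 1 - x)) \<theta>"
    by (simp add: reflect_cdf_def cdf_def)
qed

lemma real_distribution_reflect:
  assumes "real_distribution M"
  shows "real_distribution (distr M borel (\<lambda>x. 1 - x))"
proof -
  interpret real_distribution M by fact
  show ?thesis by (rule real_distribution_distr) simp
qed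

lemma CDFs_Theta_reflect:
  assumes "F \<in> CDFs_Theta"
  shows "reflect_cdf F \<in> CDFs_Theta" and "reflect_cdf (reflect_cdf F) = F"
proof -
  from assms obtain M where M: "real_distribution M" "measure M Theta = 1" "F = cdf M"
    by (auto simp: CDFs_Theta_def)
  interpret real_distribution M by fact
  let ?N = "distr M borel (\<lambda>x. 1 - x)"
  have "measure ?N Theta = measure M Theta"
    by (subst measure_distr) (auto intro!: arg_cong[where f="measure M"])
  then show "reflect_cdf F \<in> CDFs_Theta"
    unfolding CDFs_Theta_def mem_Collect_eq
    using M real_distribution_reflect[OF M(1)] reflect_cdf_cdf[OF M(1)] by (intro exI[of _ ?N]) auto
  have "distr ?N borel (\<lambda>x. 1 - x) = distr M borel (\<lambda>x. x)"
    by (subst distr_distr) (auto simp: comp_def)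
  also have "\<dots> = M" by (rule distr_id2) simp
  finally show "reflect_cdf (reflect_cdf F) = F"
    using M real_distribution_reflect[OF M(1)] by (simp add: reflect_cdf_cdf)
qed

lemma value_P_reflect:
  assumes m: "mechanism A m" and A: "bounded A" and y: "continuous_on Theta y" and F: "F \<in> CDFs_Theta"
  shows "value_P (reflect_pref \<kappa> y) (reflect_mech \<kappa> A m) (reflect_cdf F) = value_P y m F"
proof -
  from F obtain M where M: "real_distribution M" "F = cdf M"
    by (auto simp: CDFs_Theta_def)
  interpret real_distribution M by fact
  obtain B where "A \<subseteq> {-B..B}" using bounded_real_subset_Icc[OF A] .
  note f = payoff_borel_bounded(1)[OF m this y]
  let ?N = "distr M borel (\<lambda>x. 1 - x)"
  have eq: "indicator Theta x * payoff (reflect_pref \<kappa> y) (reflect_mech \<kappa> A m) x x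
      = indicator Theta (1 - x) * payoff y m (1 - x) (1 - x)" for x
    by (auto simp: indicator_def payoff_reflect[OF m])
  have "value_P (reflect_pref \<kappa> y) (reflect_mech \<kappa> A m) (reflect_cdf F)
      = (LINT x|?N. indicator Theta (1 - x) * payoff y m (1 - x) (1 - x))"
    by (simp add: M(2) reflect_cdf_cdf[OF M(1)] value_P_cdf[OF real_distribution_reflect[OF M(1)]] eq)
  also have "\<dots> = (LINT x|M. indicator Theta x * payoff y m x x)"
    using measurable_compose[OF _ f, of "\<lambda>x. 1 - x" borel] by (subst integral_distr) auto
  finally show ?thesis by (simp add: M(2) value_P_cdf[OF M(1)])
qed

text \<open>Reflection preserves incentive compatibility and value and is an involution on type
  distributions, so each deviation from the reflected pair is carried back to a deviation of equal
  value from the original one.\<close>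

lemma saddle_point_reflect:
  assumes sp: "saddle_point A yP yA m F" and A: "bounded A"
    and y: "continuous_on Theta yP" "continuous_on Theta (reflect_pref \<kappa> yP)"
  shows "saddle_point (reflect_actions \<kappa> A) (reflect_pref \<kappa> yP) (reflect_pref \<kappa> yA)
    (reflect_mech \<kappa> A m) (reflect_cdf F)"
  unfolding saddle_point_def
proof (intro conjI ballI)
  have m: "m \<in> IC_mechanisms A yA" and F: "F \<in> CDFs_Theta"
    and opt: "\<And>m' F'. m' \<in> IC_mechanisms A yA \<Longrightarrow> F' \<in> CDFs_Theta \<Longrightarrow>
      value_P yP m F' \<ge> value_P yP m F \<and> value_P yP m F \<ge> value_P yP m' F"
    using sp by (auto simp: saddle_point_def)
  have mech: "mechanism A m" using m by (simp add: IC_mechanisms_def)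
  show "reflect_mech \<kappa> A m \<in> IC_mechanisms (reflect_actions \<kappa> A) (reflect_pref \<kappa> yA)"
    by (rule IC_mechanisms_reflect[OF m])
  show "reflect_cdf F \<in> CDFs_Theta" by (rule CDFs_Theta_reflect(1)[OF F])
  note val = value_P_reflect[OF mech A y(1), of _ \<kappa>]
  fix m' F' assume m': "m' \<in> IC_mechanisms (reflect_actions \<kappa> A) (reflect_pref \<kappa> yA)" and F': "F' \<in> CDFs_Theta"
  note F'R = CDFs_Theta_reflect[OF F']
  note m'R = IC_mechanisms_reflect[OF m', of \<kappa>, simplified]
  show "value_P (reflect_pref \<kappa> yP) (reflect_mech \<kappa> A m) F'
      \<ge> value_P (reflect_pref \<kappa> yP) (reflect_mech \<kappa> A m) (reflect_cdf F)"
    using val[OF F'R(1)] val[OF F] opt[OF m F'R(1)] by (simp add: F'R(2))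
  have mech': "mechanism (reflect_actions \<kappa> A) m'" using m' by (simp add: IC_mechanisms_def)
  note bd = bounded_reflect_actions[OF A, of \<kappa>]
  have "value_P (reflect_pref \<kappa> yP) m' (reflect_cdf F) = value_P yP (reflect_mech \<kappa> (reflect_actions \<kappa> A) m') F"
    using value_P_reflect[OF mech' bd y(2) CDFs_Theta_reflect(1)[OF F], of \<kappa>] CDFs_Theta_reflect(2)[OF F] by simp
  then show "value_P (reflect_pref \<kappa> yP) (reflect_mech \<kappa> A m) (reflect_cdf F)
      \<ge> value_P (reflect_pref \<kappa> yP) m' (reflect_cdf F)"
    using val[OF F] opt[OF m'R F] by simp
qed

text \<open>The sign changes from \<open>\<kappa> - y\<close> and from \<open>1 - t\<close> cancel,
  and the one-sided derivatives at the two end points change places.\<close>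

lemma C1_Theta_reflect:
  assumes "C1_Theta y"
  shows "C1_Theta (reflect_pref \<kappa> y)"
proof -
  have D: "(reflect_pref \<kappa> y has_real_derivative deriv_Theta y (1 - t)) (at t within Theta)" if t: "t \<in> Theta" for t
  proof -
    have img: "(\<lambda>x. 1 - x) ` Theta = (Theta :: real set)"
      by (auto intro!: image_eqI[of _ _ "1 - _"])
    have "(y has_real_derivative deriv_Theta y (1 - t)) (at (1 - t) within (\<lambda>x. 1 - x) ` Theta)"
      unfolding img using t by (intro C1_Theta_has_real_derivative[OF assms]) auto
    moreover have "((\<lambda>x. 1 - x) has_real_derivative - 1) (at t within Theta)"
      by (auto intro!: derivative_eq_intros)
    ultimately have "((\<lambda>x. y (1 - x)) has_real_derivative deriv_Theta y (1 - t) * - 1) (at t within Theta)"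
      using DERIV_image_chain[of y "deriv_Theta y (1 - t)" "\<lambda>x. 1 - x" t Theta "- 1"] by (simp add: comp_def)
    then show ?thesis
      unfolding reflect_pref_def[abs_def] by (auto intro!: derivative_eq_intros)
  qed
  have eq: "deriv_Theta (reflect_pref \<kappa> y) t = deriv_Theta y (1 - t)" if "t \<in> Theta" for t
    using D[OF that] that unfolding deriv_Theta_def
    by (intro vector_derivative_within_cbox[of 0 1, simplified])
      (auto simp: has_real_derivative_iff_has_vector_derivative)
  have "continuous_on Theta (\<lambda>t. deriv_Theta y (1 - t))"
    by (rule continuous_on_compose2[of Theta "deriv_Theta y"])
      (use assms in \<open>auto simp: C1_Theta_def intro!: continuous_intros\<close>)
  then have "continuous_on Theta (deriv_Theta (reflect_pref \<kappa> y))"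
    by (rule continuous_on_cong[THEN iffD1, rotated -1]) (use eq in auto)
  moreover have "reflect_pref \<kappa> y differentiable_on Theta"
    using D unfolding differentiable_on_def has_field_derivative_def differentiable_def by blast
  ultimately show ?thesis by (simp add: C1_Theta_def)
qed

lemma strict_mono_on_reflect:
  "strict_mono_on Theta y \<Longrightarrow> strict_mono_on Theta (reflect_pref \<kappa> y)"
  by (auto simp: reflect_pref_def monotone_on_def)

theorem corollary1:
  fixes A :: "real set" and yP yA b zP zA :: "real \<Rightarrow> real" and \<kappa> :: real
    and mstar :: "real \<Rightarrow> real measure"
  assumes "is_interval A" and "compact A"
    and "yP ` Theta \<subseteq> A" and "yA ` Theta \<subseteq> A"
    and "C1_Theta yP" and "C1_Theta yA"
    and "strict_mono_on Theta yP" and "strict_mono_on Theta yA"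
    and "b = (\<lambda>\<theta>. yA \<theta> - yP \<theta>)"
    and "mono_on Theta b \<or> antimono_on Theta b"
    and "\<forall>\<theta>\<in>Theta. \<forall>\<theta>'\<in>Theta. b \<theta> = 0 \<longrightarrow> b \<theta>' = 0 \<longrightarrow> \<theta> = \<theta>'"
    and "\<forall>\<theta>\<in>Theta. yA \<theta> \<le> yP \<theta>"
    and "\<kappa> = yP 0 + yP 1"
    and "zP = reflect_pref \<kappa> yP" and "zA = reflect_pref \<kappa> yA"
    and "zA 0 < zP 1"
    and "pb_mechanism (reflect_actions \<kappa> A) zP zA mstar"
  shows "saddle_point A yP yA
           (reflect_mech \<kappa> (reflect_actions \<kappa> A) mstar) (reflect_cdf (pb_cdf zP zA))"
proof -
  \<comment> \<open>Reversing both sign and type makes the nonpositive bias nonnegative while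
    keeping its direction of monotonicity.\<close>
  have c: "pb_c zP zA \<theta> = - b (1 - \<theta>)" for \<theta>
    by (simp add: pb_c_def assms(9,14,15) reflect_pref_def)
  interpret positive_bias zP zA
  proof
    show "C1_Theta zP" "C1_Theta zA"
      unfolding assms(14,15) by (intro C1_Theta_reflect assms)+
    show "strict_mono_on Theta zP" "strict_mono_on Theta zA"
      unfolding assms(14,15) by (intro strict_mono_on_reflect assms)+
    show "0 \<le> pb_c zP zA \<theta>" if "\<theta> \<in> Theta" for \<theta>
      using assms(12) that by (simp add: c assms(9))
    show "mono_on Theta (pb_c zP zA) \<or> antimono_on Theta (pb_c zP zA)"
      using assms(10) by (auto simp: monotone_on_def c)
    show "\<theta> = \<theta>'" if "\<theta> \<in> Theta" "\<theta>' \<in> Theta" "pb_c zP zA \<theta> = 0" "pb_c zP zA \<theta>' = 0" for \<theta> \<theta>'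
      using assms(11)[rule_format, of "1 - \<theta>" "1 - \<theta>'"] that by (auto simp: c)
  qed fact
  note bd = bounded_reflect_actions[OF compact_imp_bounded[OF assms(2)], of \<kappa>]
  obtain B where "reflect_actions \<kappa> A \<subseteq> {-B..B}" using bounded_real_subset_Icc[OF bd] .
  from pb_saddle_point[OF assms(17) this]
  have "saddle_point (reflect_actions \<kappa> A) zP zA mstar (pb_cdf zP zA)" .
  \<comment> \<open>A second reflection with the same \<open>\<kappa>\<close> restores preferences
    and action space by the involution rules.\<close>
  from saddle_point_reflect[OF this bd cont_P, of \<kappa>] show ?thesis
    using C1_Theta_continuous_on[OF assms(5)] by (simp add: assms(14,15))
qed

end
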